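(* Let $X\ne\{0\}$ be a complex Banach space with open unit ball $B_X$. Let $k,m\in\mathbb{N}$, $p\in(0,2]$ and $\lambda\in(0,\infty)$, and let $R_3=R^{k,m}_{\lambda,p}$ be the unique root in $(0,1)$ of the equation $$p\,\frac{1-r^m}{1+r^m}-2\lambda\frac{r^k}{1-r^k}=0 .$$ Let $f:B_X\to\mathbb{D}$ be holomorphic with homogeneous polynomial expansion $f(z)=\sum_{j=0}^\infty P_j(z)$, $z\in B_X$, and $a=|f(0)|$. For $n\in\mathbb{N}$ let $\mu_n:B_X\to B_X$ be a Schwarz mapping having a zero of order $n$ at $z=0$. Then $$I_f(z):=|f(\mu_m(z))|^p+\lambda\Big[\sum_{j=1}^\infty|P_j(\mu_k(z))|+\Big(\frac1{1+a}+\frac{r^k}{1-r^k}\Big)\sum_{j=1}^\infty|P_j(\mu_k(z))|^2\Big]\le1$$ for $\|z\|=r\le R_3$. The radius $R_3$ is best possible: for every $R\in(R_3,1)$ there exist such $f$ and $\mu_n$ ($n\ge1$) and a point $z\in B_X$ with $\|z\|=r\le R$ such that $I_f(z)>1$.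
   Context: $\mathbb{N}=\{1,2,\dots\}$ and $\mathbb{D}=\{z\in\mathbb{C}:|z|<1\}$. A homogeneous polynomial of degree $j$ on $X$ is a map $P_j(x)=u(x,\dots,x)$ for a (continuous) $j$-linear map $u$ on $X^j$; $P_0$ is the constant $f(0)$. Every holomorphic $f:B_X\to\mathbb{D}$ has a unique expansion $f(z)=\sum_{j\ge0}P_j(z)$ on $B_X$ with $P_j$ homogeneous of degree $j$. A Schwarz mapping is a holomorphic map $\mu:B_X\to B_X$ with $\mu(0)=0$; it has a zero of order $n$ at $0$ if the first non-zero term of its homogeneous polynomial expansion at $0$ has degree $n$. *)

theory Defs
  imports "HOL-Analysis.Analysis"
begin

class complex_normed_vector = real_normed_vector +
  fixes scaleC :: "complex \<Rightarrow> 'a \<Rightarrow> 'a" (infixr \<open>*\<^sub>C\<close> 75)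
  assumes scaleC_add_right: "c *\<^sub>C (x + y) = c *\<^sub>C x + c *\<^sub>C y"
    and scaleC_add_left: "(c + d) *\<^sub>C x = c *\<^sub>C x + d *\<^sub>C x"
    and scaleC_scaleC: "c *\<^sub>C d *\<^sub>C x = (c * d) *\<^sub>C x"
    and scaleC_of_real: "complex_of_real r *\<^sub>C x = r *\<^sub>R x"
    and norm_scaleC: "norm (c *\<^sub>C x) = cmod c * norm x"

class complex_banach = complex_normed_vector + complete_space

instantiation complex :: complex_banach
begin

definition scaleC_complex :: "complex \<Rightarrow> complex \<Rightarrow> complex" where
  "scaleC_complex c x = c * x"

instance
  by standard (simp_all add: scaleC_complex_def algebra_simps norm_mult scaleR_conv_of_real)

end

text \<open>Holomorphy on an open set means Frechet differentiability with complex-linear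
  derivative; real linearity and boundedness of the derivative are part of
  \<open>has_derivative\<close>.\<close>

definition holomorphic_map_on ::
    "('a::complex_normed_vector \<Rightarrow> 'b::complex_normed_vector) \<Rightarrow> 'a set \<Rightarrow> bool" where
  "holomorphic_map_on f S \<longleftrightarrow>
     (\<forall>x\<in>S. \<exists>D. (f has_derivative D) (at x) \<and> (\<forall>c v. D (c *\<^sub>C v) = c *\<^sub>C D v))"

text \<open>A \<open>j\<close>-linear map on \<open>X\<^sup>j\<close> is encoded as a function on sequences that depends only on the
  entries with index below \<open>j\<close>. With the product topology on sequences, continuity of such a
  function is continuity on \<open>X\<^sup>j\<close>. For \<open>j = 0\<close> these are the constants.\<close>

definition multilinear_map ::
    "nat \<Rightarrow> ((nat \<Rightarrow> 'a::complex_normed_vector) \<Rightarrow> 'b::complex_normed_vector) \<Rightarrow> bool" where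
  "multilinear_map j u \<longleftrightarrow>
     (\<forall>x y. (\<forall>i<j. x i = y i) \<longrightarrow> u x = u y) \<and>
     (\<forall>x. \<forall>i<j. \<forall>v w. u (x(i := v + w)) = u (x(i := v)) + u (x(i := w))) \<and>
     (\<forall>x. \<forall>i<j. \<forall>c v. u (x(i := c *\<^sub>C v)) = c *\<^sub>C u (x(i := v)))"

definition homogeneous_polynomial ::
    "nat \<Rightarrow> ('a::complex_normed_vector \<Rightarrow> 'b::complex_normed_vector) \<Rightarrow> bool" where
  "homogeneous_polynomial j P \<longleftrightarrow>
     (\<exists>u. multilinear_map j u \<and> continuous_on UNIV u \<and> (\<forall>x. P x = u (\<lambda>_. x)))"

definition homogeneous_expansion ::
    "('a::complex_normed_vector \<Rightarrow> 'b::complex_normed_vector) \<Rightarrow> (nat \<Rightarrow> 'a \<Rightarrow> 'b) \<Rightarrow> bool" where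
  "homogeneous_expansion f P \<longleftrightarrow>
     (\<forall>j. homogeneous_polynomial j (P j)) \<and> (\<forall>z\<in>ball 0 1. (\<lambda>j. P j z) sums f z)"

definition schwarz_mapping :: "('a::complex_normed_vector \<Rightarrow> 'a) \<Rightarrow> bool" where
  "schwarz_mapping \<mu> \<longleftrightarrow>
     holomorphic_map_on \<mu> (ball 0 1) \<and> \<mu> ` ball 0 1 \<subseteq> ball 0 1 \<and> \<mu> 0 = 0"

definition zero_of_order_at_0 ::
    "nat \<Rightarrow> ('a::complex_normed_vector \<Rightarrow> 'b::complex_normed_vector) \<Rightarrow> bool" where
  "zero_of_order_at_0 n g \<longleftrightarrow>
     (\<exists>Q. homogeneous_expansion g Q \<and> (\<exists>x. Q n x \<noteq> 0) \<and> (\<forall>j<n. \<forall>x. Q j x = 0))"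

definition is_bohr_root :: "nat \<Rightarrow> nat \<Rightarrow> real \<Rightarrow> real \<Rightarrow> real \<Rightarrow> bool" where
  "is_bohr_root k m lam p r \<longleftrightarrow>
     0 < r \<and> r < 1 \<and> p * ((1 - r ^ m) / (1 + r ^ m)) - 2 * lam * (r ^ k / (1 - r ^ k)) = 0"

definition bohr_radius :: "nat \<Rightarrow> nat \<Rightarrow> real \<Rightarrow> real \<Rightarrow> real" where
  "bohr_radius k m lam p = (THE r. is_bohr_root k m lam p r)"

definition bohr_sum ::
    "nat \<Rightarrow> nat \<Rightarrow> real \<Rightarrow> real \<Rightarrow> ('a::complex_normed_vector \<Rightarrow> complex) \<Rightarrow>
     (nat \<Rightarrow> 'a \<Rightarrow> complex) \<Rightarrow> (nat \<Rightarrow> 'a \<Rightarrow> 'a) \<Rightarrow> 'a \<Rightarrow> real" where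
  "bohr_sum k m lam p f P \<mu> z =
     cmod (f (\<mu> m z)) powr p +
     lam * ((\<Sum>j. cmod (P (Suc j) (\<mu> k z))) +
            (1 / (1 + cmod (f 0)) + norm z ^ k / (1 - norm z ^ k)) *
              (\<Sum>j. (cmod (P (Suc j) (\<mu> k z)))\<^sup>2))"

text \<open>Convergence of the two series in \<open>bohr_sum\<close>, stated separately because \<open>suminf\<close> is
  unspecified for divergent series.\<close>

definition bohr_sum_converges ::
    "nat \<Rightarrow> (nat \<Rightarrow> 'a::complex_normed_vector \<Rightarrow> complex) \<Rightarrow> (nat \<Rightarrow> 'a \<Rightarrow> 'a) \<Rightarrow> 'a \<Rightarrow> bool" where
  "bohr_sum_converges k P \<mu> z \<longleftrightarrow>
     summable (\<lambda>j. cmod (P (Suc j) (\<mu> k z))) \<and>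
     summable (\<lambda>j. (cmod (P (Suc j) (\<mu> k z)))\<^sup>2)"

definition admissible ::
    "('a::complex_normed_vector \<Rightarrow> complex) \<Rightarrow> (nat \<Rightarrow> 'a \<Rightarrow> complex) \<Rightarrow> (nat \<Rightarrow> 'a \<Rightarrow> 'a) \<Rightarrow> bool" where
  "admissible f P \<mu> \<longleftrightarrow>
     holomorphic_map_on f (ball 0 1) \<and> f ` ball 0 1 \<subseteq> ball 0 1 \<and>
     homogeneous_expansion f P \<and>
     (\<forall>n\<ge>1. schwarz_mapping (\<mu> n) \<and> zero_of_order_at_0 n (\<mu> n))"

end

theory Submission
  imports Defs "HOL-Complex_Analysis.Riemann_Mapping"
begin

text \<open>On a complex line through \<open>0\<close> the homogeneous expansion of \<open>f\<close> is a power series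
  \<open>\<Sum> a\<^sub>j z\<^sup>j\<close> bounded by \<open>1\<close>. Multiplication by it does not increase the Hardy space norm, and
  testing this on suitable polynomials gives Carlson's bounds for \<open>a\<^sub>j\<close>, whose sum is
  \<open>\<Sum> norm a\<^sub>j s\<^sup>j + (1 / (1 + a) + s / (1 - s)) \<Sum> (norm a\<^sub>j)\<^sup>2 s\<^sup>2\<^sup>j \<le> (1 - a\<^sup>2) s / (1 - s)\<close>. The Schwarz lemma
  \<open>norm (\<mu>\<^sub>n z) \<le> norm z ^ n\<close> allows \<open>s = r\<^sup>k\<close>, and with \<open>t = r\<^sup>m\<close> the Schwarz--Pick bound
  \<open>x = (a + t) / (1 + a t)\<close> for the first term and \<open>x\<^sup>p \<le> 1 - (p / 2) (1 - x\<^sup>2)\<close>, which needs \<open>p \<le> 2\<close>, leave exactly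
  the inequality that defines the radius. For sharpness, compose a Moebius function with a norming functional
  and let \<open>a\<close> tend to \<open>1\<close>.\<close>

text \<open>The weight in front of the squares comes from a count. Carlson's bound is
  \<open>1 - (\<Sum>i\<le>n. (norm (a i))\<^sup>2)\<close> for the index \<open>2 n + 1\<close> and
  \<open>1 - (\<Sum>i<n. (norm (a i))\<^sup>2) - (norm (a n))\<^sup>2 / (1 + norm (a 0))\<close> for
  the index \<open>2 n\<close>. So for \<open>n \<ge> 1\<close> the square of
  \<open>norm (a n)\<close> is subtracted with weight \<open>1 / (1 + norm (a 0))\<close> in degree
  \<open>2 n\<close> and with weight 1 in every later degree. With the powers of \<open>s\<close>
  this makes \<open>s ^ (2 n)\<close> times \<open>1 / (1 + norm (a 0)) + s / (1 - s)\<close>,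
  exactly what the squared series adds back; only the geometric series with factor
  \<open>1 - (norm (a 0))\<^sup>2\<close> is left. The Schwarz mappings take values in
  \<open>X\<close>, so their bound needs a Schwarz lemma for power series with vector coefficients.
  Truncating the series and averaging over roots of unity provides it with finite sums alone, and
  the same averages replace circle integrals in the Hardy space estimate.\<close>

instance complex_banach \<subseteq> banach ..

section \<open>Arithmetic of complex scalar multiplication\<close>

lemma scaleC_zero_left [simp]: "0 *\<^sub>C x = 0"
  using scaleC_of_real[of 0 x] by simp

lemma scaleC_zero_right [simp]: "c *\<^sub>C 0 = (0::'a::complex_normed_vector)"
  using scaleC_add_right[of c 0 "0::'a"] by simp

lemma scaleC_one [simp]: "1 *\<^sub>C x = x"
  using scaleC_of_real[of 1 x] by simp

lemma scaleC_minus_left: "(- c) *\<^sub>C x = - (c *\<^sub>C x)"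
  using scaleC_add_left[of c "- c" x] by (simp add: add_eq_0_iff2)

lemma scaleR_scaleC: "r *\<^sub>R c *\<^sub>C x = (complex_of_real r * c) *\<^sub>C x"
  by (simp add: scaleC_of_real[symmetric] scaleC_scaleC)

lemma scaleC_sum_left: "(\<Sum>i\<in>A. c i) *\<^sub>C x = (\<Sum>i\<in>A. c i *\<^sub>C x)"
  by (induction A rule: infinite_finite_induct) (simp_all add: scaleC_add_left)

lemma scaleC_sum_right: "c *\<^sub>C (\<Sum>i\<in>A. f i) = (\<Sum>i\<in>A. c *\<^sub>C f i)"
  by (induction A rule: infinite_finite_induct) (simp_all add: scaleC_add_right)

lemma bounded_bilinear_scaleC:
  "bounded_bilinear (\<lambda>(c::complex) (x::'a::complex_normed_vector). c *\<^sub>C x)"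
proof
  fix c d :: complex and x y :: 'a and r :: real
  show "(c + d) *\<^sub>C x = c *\<^sub>C x + d *\<^sub>C x" by (rule scaleC_add_left)
  show "c *\<^sub>C (x + y) = c *\<^sub>C x + c *\<^sub>C y" by (rule scaleC_add_right)
  show "(r *\<^sub>R c) *\<^sub>C x = r *\<^sub>R c *\<^sub>C x" by (simp add: scaleR_scaleC scaleR_conv_of_real)
  show "c *\<^sub>C r *\<^sub>R x = r *\<^sub>R c *\<^sub>C x"
    by (simp add: scaleC_of_real[symmetric] scaleC_scaleC mult.commute)
  show "\<exists>K. \<forall>(c::complex) (x::'a). norm (c *\<^sub>C x) \<le> norm c * norm x * K"
    by (intro exI[of _ 1]) (simp add: norm_scaleC)
qed

subsection \<open>Averages over roots of unity\<close>

text \<open>Averaging over the \<open>M\<close>-th roots of unity integrates trigonometric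
  polynomials of degree below \<open>M\<close> over the circle without error.\<close>

definition unity_root :: "nat \<Rightarrow> nat \<Rightarrow> complex" where
  "unity_root M l = exp (2 * of_real pi * \<i> * of_nat l / of_nat M)"

lemma norm_unity_root [simp]: "norm (unity_root M l) = 1"
proof -
  have "unity_root M l = exp (\<i> * of_real (2 * pi * l / M))"
    unfolding unity_root_def by (simp add: algebra_simps)
  then show ?thesis by (simp only: norm_exp_i_times)
qed

lemma unity_root_power: "unity_root M l ^ j = unity_root M j ^ l"
  unfolding unity_root_def exp_of_nat_mult[symmetric] by (simp add: algebra_simps)

text \<open>By the symmetry \<open>unity_root_power\<close> the sum over \<open>l\<close> is
  geometric with ratio \<open>x\<close>, an \<open>M\<close>-th root of unity. Since
  \<open>i\<close> and \<open>j\<close> are below \<open>M\<close>, this ratio is 1 only for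
  \<open>i = j\<close>.\<close>

lemma unity_root_orthogonal:
  assumes "i < M" "j < M"
  shows "(\<Sum>l<M. unity_root M l ^ i * cnj (unity_root M l) ^ j) = (if i = j then of_nat M else 0)"
proof -
  define x where "x = unity_root M i * cnj (unity_root M j)"
  have cn: "unity_root M j * cnj (unity_root M j) = 1" for j
    using complex_norm_square[of "unity_root M j"] by simp
  have pow: "unity_root M l ^ i * cnj (unity_root M l) ^ j = x ^ l" for l
    by (simp add: x_def power_mult_distrib unity_root_power[of M l i] unity_root_power[of M l j]
        complex_cnj_power[symmetric] del: complex_cnj_power)
  have unM: "unity_root M i ^ M = 1" for i
    using assms exp_two_pi_i complex_root_unity[of M i] by (simp add: unity_root_def)
  show ?thesis
  proof (cases "i = j")
    case True
    then have "x = 1" using cn by (simp add: x_def)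
    then show ?thesis unfolding pow using True by simp
  next
    case False
    have "x \<noteq> 1"
    proof
      assume "x = 1"
      then have "unity_root M i * (cnj (unity_root M j) * unity_root M j) = unity_root M j"
        by (simp add: x_def mult.assoc[symmetric])
      then have "unity_root M i = unity_root M j" using cn[of j] by (simp add: mult.commute)
      then show False
        using complex_root_unity_eq[of M i j] assms False by (simp add: unity_root_def)
    qed
    moreover have "x ^ M = 1"
      by (simp add: x_def power_mult_distrib unM complex_cnj_power[symmetric] del: complex_cnj_power)
    ultimately show ?thesis using False by (simp add: pow sum_gp_strict)
  qed
qed

lemma sum_rotate:
  "(\<Sum>l\<in>A. \<Sum>i\<in>B. \<Sum>j\<in>C. f l i j) = (\<Sum>i\<in>B. \<Sum>j\<in>C. \<Sum>l\<in>A. f l i j)"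
  by (rule trans[OF sum.swap]) (intro sum.cong refl sum.swap)

lemma unity_root_Parseval:
  assumes "N \<le> M"
  shows "(\<Sum>l<M. (norm (\<Sum>j<N. d j * unity_root M l ^ j))\<^sup>2) = M * (\<Sum>j<N. (norm (d j))\<^sup>2)"
proof -
  have "complex_of_real (\<Sum>l<M. (norm (\<Sum>j<N. d j * unity_root M l ^ j))\<^sup>2)
      = (\<Sum>l<M. \<Sum>i<N. \<Sum>j<N. d i * cnj (d j) * (unity_root M l ^ i * cnj (unity_root M l) ^ j))"
    by (simp add: complex_norm_square sum_product mult_ac del: of_real_power)
  also have "\<dots> = (\<Sum>i<N. \<Sum>j<N. d i * cnj (d j) * (\<Sum>l<M. unity_root M l ^ i * cnj (unity_root M l) ^ j))"
    by (simp add: sum_rotate[where A = "{..<M}"] sum_distrib_left)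
  also have "\<dots> = (\<Sum>i<N. \<Sum>j<N. d i * cnj (d j) * (if i = j then of_nat M else 0))"
    using assms by (intro sum.cong refl arg_cong2[where f = "(*)"] unity_root_orthogonal) auto
  also have "\<dots> = (\<Sum>i<N. d i * cnj (d i) * of_nat M)"
    by (intro sum.cong refl) (simp add: if_distrib[where f = "\<lambda>x. _ * x"] sum.delta cong: if_cong)
  also have "\<dots> = complex_of_real (M * (\<Sum>j<N. (norm (d j))\<^sup>2))"
    by (simp add: complex_norm_square sum_distrib_left mult_ac del: of_real_power)
  finally show ?thesis by (simp only: of_real_eq_iff)
qed

subsection \<open>The Schwarz lemma for vector-valued power series\<close>

text \<open>Averaging against nonnegative weights works for vector values. The weights
  \<open>W l\<close> have total \<open>M * C L\<close>, and their moment against the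
  \<open>j\<close>-th powers is \<open>M * C (L - j)\<close> times \<open>z ^ j\<close>. As
  \<open>C (L - j) / C L\<close> tends to 1, the averages reproduce the value at \<open>z\<close> in
  the limit.\<close>

lemma polynomial_maximum_principle:
  fixes p :: "nat \<Rightarrow> 'a::complex_normed_vector"
  assumes bound: "\<And>w. norm w = 1 \<Longrightarrow> norm (\<Sum>j<N. w ^ j *\<^sub>C p j) \<le> B"
    and z: "norm z < 1"
  shows "norm (\<Sum>j<N. z ^ j *\<^sub>C p j) \<le> B"
proof -
  define C where "C L = (\<Sum>i<L. (norm z ^ 2) ^ i)" for L :: nat
  \<comment> \<open>The squared partial sums of a geometric series form an approximate Poisson kernel.\<close>
  have kernel: "norm (\<Sum>j<N. complex_of_real (C (L - j)) *\<^sub>C z ^ j *\<^sub>C p j) \<le> B * C L" for L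
  proof -
    \<comment> \<open>\<open>M\<close> exceeds every exponent \<open>i + j\<close> with
      \<open>i < L\<close> and \<open>j < N\<close>, so that no two exponents coincide modulo
      \<open>M\<close>.\<close>
    define M where "M = Suc (L + N)"
    let ?w = "unity_root M"
    define W where "W l = (norm (\<Sum>i<L. cnj z ^ i * ?w l ^ i))\<^sup>2" for l
    have Wn: "W l \<ge> 0" for l by (simp add: W_def)
    have sq: "complex_of_real (((norm z)\<^sup>2) ^ i) = z ^ i * cnj z ^ i" for i
      by (simp only: of_real_power[of _ i] complex_norm_square power_mult_distrib)
    have W: "(\<Sum>l<M. complex_of_real (W l) * ?w l ^ j) = of_nat M * (complex_of_real (C (L - j)) * z ^ j)"
      if j: "j < N" for j
    proof -
      have "(\<Sum>l<M. complex_of_real (W l) * ?w l ^ j)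
          = (\<Sum>l<M. \<Sum>i<L. \<Sum>i'<L. cnj z ^ i * z ^ i' * (?w l ^ (i + j) * cnj (?w l) ^ i'))"
        by (simp add: W_def complex_norm_square sum_product sum_distrib_right sum_distrib_left
            mult_ac power_add del: of_real_power)
      also have "\<dots> = (\<Sum>i<L. \<Sum>i'<L. cnj z ^ i * z ^ i' * (\<Sum>l<M. ?w l ^ (i + j) * cnj (?w l) ^ i'))"
        by (simp add: sum_rotate[where A = "{..<M}"] sum_distrib_left)
      also have "\<dots> = (\<Sum>i<L. \<Sum>i'<L. cnj z ^ i * z ^ i' * (if i + j = i' then of_nat M else 0))"
        using j by (intro sum.cong refl arg_cong2[where f = "(*)"] unity_root_orthogonal)
          (auto simp: M_def)
      \<comment> \<open>The only surviving \<open>i'\<close> is \<open>i + j\<close>, which must lie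
        below \<open>L\<close>. For \<open>j \<ge> L\<close> the truncated subtraction yields the
        empty sum, as it should.\<close>
      also have "\<dots> = (\<Sum>i<L. if i < L - j then cnj z ^ i * z ^ (i + j) * of_nat M else 0)"
        by (intro sum.cong refl) (auto simp: if_distrib[where f = "\<lambda>x. _ * x"] sum.delta' cong: if_cong)
      also have "\<dots> = (\<Sum>i<L - j. cnj z ^ i * z ^ (i + j) * of_nat M)"
        by (rule sum.mono_neutral_cong_right) auto
      also have "\<dots> = of_nat M * (complex_of_real (C (L - j)) * z ^ j)"
        by (simp add: C_def sq sum_distrib_left sum_distrib_right power_add mult_ac del: of_real_power)
      finally show ?thesis .
    qed
    have W0: "(\<Sum>l<M. W l) = M * C L"
    proof -
      have "(\<Sum>l<M. W l) = M * (\<Sum>i<L. (norm (cnj z ^ i))\<^sup>2)"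
        unfolding W_def by (rule unity_root_Parseval) (simp add: M_def)
      then show ?thesis by (simp add: C_def norm_power power_mult[symmetric] mult.commute)
    qed
    have "of_nat M *\<^sub>C (\<Sum>j<N. complex_of_real (C (L - j)) *\<^sub>C z ^ j *\<^sub>C p j)
        = (\<Sum>j<N. (\<Sum>l<M. complex_of_real (W l) * ?w l ^ j) *\<^sub>C p j)"
      by (simp add: W scaleC_sum_right scaleC_scaleC)
    also have "\<dots> = (\<Sum>l<M. complex_of_real (W l) *\<^sub>C (\<Sum>j<N. ?w l ^ j *\<^sub>C p j))"
      by (simp add: scaleC_sum_left scaleC_sum_right scaleC_scaleC) (rule sum.swap)
    also have "norm \<dots> \<le> (\<Sum>l<M. W l * B)"
      by (intro sum_norm_le) (simp add: norm_scaleC Wn mult_left_mono bound)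
    also have "\<dots> = M * (B * C L)" by (simp add: W0 sum_distrib_right[symmetric])
    finally have "M * norm (\<Sum>j<N. complex_of_real (C (L - j)) *\<^sub>C z ^ j *\<^sub>C p j) \<le> M * (B * C L)"
      by (simp only: norm_scaleC norm_of_nat)
    then show ?thesis by (rule mult_left_le_imp_le) (simp add: M_def)
  qed
  have z2: "norm z ^ 2 < 1" using z by (simp add: power_less_one_iff abs_square_less_1)
  define c where "c = 1 / (1 - norm z ^ 2)"
  have c: "c > 0" using z2 by (simp add: c_def)
  have C: "C \<longlonglongrightarrow> c"
    using geometric_sums[of "norm z ^ 2"] z2 by (simp add: sums_def C_def[abs_def] c_def)
  have Cs: "(\<lambda>L. C (L - j)) \<longlonglongrightarrow> c" for j
    by (rule LIMSEQ_offset[where k = j]) (simp add: C)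
  interpret scaleC: bounded_bilinear "\<lambda>(c::complex) (x::'a). c *\<^sub>C x"
    by (rule bounded_bilinear_scaleC)
  have "(\<lambda>L. norm (\<Sum>j<N. complex_of_real (C (L - j)) *\<^sub>C z ^ j *\<^sub>C p j))
      \<longlonglongrightarrow> norm (\<Sum>j<N. complex_of_real c *\<^sub>C z ^ j *\<^sub>C p j)"
    by (intro tendsto_norm tendsto_sum scaleC.tendsto tendsto_const tendsto_of_real Cs)
  moreover have "(\<lambda>L. B * C L) \<longlonglongrightarrow> B * c" by (intro tendsto_intros C)
  ultimately have "norm (\<Sum>j<N. complex_of_real c *\<^sub>C z ^ j *\<^sub>C p j) \<le> B * c"
    by (rule LIMSEQ_le) (use kernel in auto)
  then show ?thesis
    using c by (simp add: scaleC_sum_right[symmetric] norm_scaleC mult.commute)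
qed

text \<open>Convergence at one radius \<open>s\<close> between \<open>r\<close> and 1 bounds
  \<open>s ^ j * norm (q j)\<close>, so on \<open>cball 0 r\<close> the terms are dominated by a
  geometric series of ratio \<open>r / s\<close>.\<close>

lemma power_series_uniform_limit:
  fixes q :: "nat \<Rightarrow> 'a::complex_banach"
  assumes F: "\<And>z. norm z < 1 \<Longrightarrow> (\<lambda>j. z ^ j *\<^sub>C q j) sums F z" and r: "0 < r" "r < 1"
  shows "uniform_limit (cball 0 r) (\<lambda>N z. \<Sum>j<N. z ^ j *\<^sub>C q j) F sequentially"
proof -
  define s where "s = (1 + r) / 2"
  have s: "r < s" "s < 1" using r by (auto simp: s_def)
  have "(\<lambda>j. complex_of_real s ^ j *\<^sub>C q j) \<longlonglongrightarrow> 0"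
    using F[of "of_real s"] s r by (intro summable_LIMSEQ_zero sums_summable) auto
  then have "Bseq (\<lambda>j. complex_of_real s ^ j *\<^sub>C q j)"
    by (intro convergent_imp_Bseq convergentI)
  then obtain K where K: "\<And>j. norm (complex_of_real s ^ j *\<^sub>C q j) \<le> K"
    by (meson BseqE)
  have le: "norm (z ^ j *\<^sub>C q j) \<le> K * (r / s) ^ j" if "z \<in> cball 0 r" for z j
  proof -
    have "norm (z ^ j *\<^sub>C q j) \<le> r ^ j * norm (q j)"
      using that by (simp add: norm_scaleC norm_power mult_right_mono power_mono)
    also have "\<dots> = (r / s) ^ j * norm (complex_of_real s ^ j *\<^sub>C q j)"
      using s r by (simp add: norm_scaleC norm_power power_divide)
    also have "\<dots> \<le> (r / s) ^ j * K" using K s r by (intro mult_left_mono) auto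
    finally show ?thesis by (simp add: mult.commute)
  qed
  have "uniform_limit (cball 0 r) (\<lambda>N z. \<Sum>j<N. z ^ j *\<^sub>C q j) (\<lambda>z. \<Sum>j. z ^ j *\<^sub>C q j) sequentially"
    by (rule Weierstrass_m_test[OF le]) (use s r in \<open>auto intro!: summable_mult summable_geometric\<close>)
  then show ?thesis
    by (subst uniform_limit_cong'[OF refl, where i = "\<lambda>z. \<Sum>j. z ^ j *\<^sub>C q j"])
      (use F r in \<open>auto simp: sums_iff\<close>)
qed

text \<open>The classical division by \<open>z ^ n\<close>, performed on truncations: they
  approximate \<open>F\<close> uniformly on a smaller disc and contain the factor
  \<open>w ^ n\<close> explicitly. On the unit circle removing this factor leaves the norm
  unchanged, so the quotient polynomial obeys the maximum principle with the bound of
  \<open>F\<close>, up to the approximation error.\<close>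

lemma power_series_Schwarz:
  fixes q :: "nat \<Rightarrow> 'a::complex_banach"
  assumes F: "\<And>z. norm z < 1 \<Longrightarrow> (\<lambda>j. z ^ j *\<^sub>C q j) sums F z"
    and F1: "\<And>z. norm z < 1 \<Longrightarrow> norm (F z) \<le> 1"
    and q: "\<And>j. j < n \<Longrightarrow> q j = 0"
    and z: "norm z < 1"
  shows "norm (F z) \<le> norm z ^ n"
proof -
  have shift: "(\<Sum>j<N + n. w ^ j *\<^sub>C q j) = w ^ n *\<^sub>C (\<Sum>j<N. w ^ j *\<^sub>C q (j + n))" for w N
  proof -
    have "(\<Sum>j<N + n. w ^ j *\<^sub>C q j) = (\<Sum>j\<in>{n..<N + n}. w ^ j *\<^sub>C q j)"
      by (rule sum.mono_neutral_right) (auto simp: q)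
    also have "\<dots> = (\<Sum>j<N. w ^ (j + n) *\<^sub>C q (j + n))"
      using sum.shift_bounds_nat_ivl[of "\<lambda>j. w ^ j *\<^sub>C q j" 0 n N] by (simp add: lessThan_atLeast0)
    finally show ?thesis by (simp add: scaleC_sum_right scaleC_scaleC power_add mult.commute)
  qed
  have dil: "norm (F (of_real r * u)) \<le> norm u ^ n" if r: "0 < r" "r < 1" and u: "norm u < 1" for r u
  proof (rule field_le_epsilon)
    fix e :: real assume e: "e > 0"
    have "\<forall>\<^sub>F N in sequentially. \<forall>w\<in>cball 0 r. dist (\<Sum>j<N. w ^ j *\<^sub>C q j) (F w) < e / 2"
      using uniform_limitD[OF power_series_uniform_limit[OF F r], of "e / 2"] e by simp
    then obtain N0 where "\<And>N w. N \<ge> N0 \<Longrightarrow> w \<in> cball 0 r \<Longrightarrow> dist (\<Sum>j<N. w ^ j *\<^sub>C q j) (F w) < e / 2"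
      unfolding eventually_sequentially by blast
    then have N: "dist (\<Sum>j<N0 + n. w ^ j *\<^sub>C q j) (F w) < e / 2" if "norm w \<le> r" for w
      using that by auto
    \<comment> \<open>Coefficients of the quotient by \<open>w ^ n\<close> of the truncation with
      \<open>N0 + n\<close> terms, dilated by \<open>r\<close> so that the unit circle lands where
      the approximation is uniform.\<close>
    define p where "p j = complex_of_real r ^ (j + n) *\<^sub>C q (j + n)" for j
    have sump: "w ^ n *\<^sub>C (\<Sum>j<N0. w ^ j *\<^sub>C p j) = (\<Sum>j<N0 + n. (of_real r * w) ^ j *\<^sub>C q j)" for w
      unfolding shift p_def
      by (simp add: scaleC_sum_right scaleC_scaleC power_mult_distrib power_add mult_ac)
    have "norm (\<Sum>j<N0. u ^ j *\<^sub>C p j) \<le> 1 + e / 2"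
    proof (rule polynomial_maximum_principle[OF _ u])
      fix w :: complex assume w: "norm w = 1"
      have "norm (\<Sum>j<N0. w ^ j *\<^sub>C p j) = norm (\<Sum>j<N0 + n. (of_real r * w) ^ j *\<^sub>C q j)"
        unfolding sump[symmetric] by (simp add: norm_scaleC norm_power w)
      also have "\<dots> \<le> norm (F (of_real r * w)) + e / 2"
        using N[of "of_real r * w"] r w norm_triangle_sub[of "(\<Sum>j<N0 + n. (of_real r * w) ^ j *\<^sub>C q j)" "F (of_real r * w)"]
        by (simp add: dist_norm norm_mult)
      also have "\<dots> \<le> 1 + e / 2" using F1 r w by (simp add: norm_mult)
      finally show "norm (\<Sum>j<N0. w ^ j *\<^sub>C p j) \<le> 1 + e / 2" .
    qed
    then have "norm (\<Sum>j<N0 + n. (of_real r * u) ^ j *\<^sub>C q j) \<le> norm u ^ n * (1 + e / 2)"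
      unfolding sump[symmetric] by (simp add: norm_scaleC norm_power mult_left_mono)
    also have "\<dots> \<le> norm u ^ n + e / 2"
      using u e mult_right_mono[OF power_le_one[of "norm u" n], of "e / 2"] by (simp add: algebra_simps)
    finally have "norm (\<Sum>j<N0 + n. (of_real r * u) ^ j *\<^sub>C q j) \<le> norm u ^ n + e / 2" .
    moreover have "norm (of_real r * u) \<le> r" using r u by (simp add: norm_mult mult_left_le)
    ultimately show "norm (F (of_real r * u)) \<le> norm u ^ n + e"
      using N[of "of_real r * u"]
        norm_triangle_sub[of "F (of_real r * u)" "(\<Sum>j<N0 + n. (of_real r * u) ^ j *\<^sub>C q j)"]
      by (simp add: dist_norm norm_minus_commute)
  qed
  \<comment> \<open>Taking \<open>u = z / r\<close> in \<open>dil\<close> undoes the dilation; then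
    \<open>r\<close> tends to 1 from below.\<close>
  have "((\<lambda>r. (norm z / r) ^ n) \<longlongrightarrow> (norm z / 1) ^ n) (at_left 1)"
    by (intro tendsto_intros) auto
  moreover have "\<forall>\<^sub>F r in at_left 1. norm (F z) \<le> (norm z / r) ^ n"
  proof (rule eventually_at_leftI[of "norm z"])
    fix r assume "r \<in> {norm z<..<1}"
    then have r: "norm z < r" "0 < r" "r < 1" using norm_ge_zero[of z] by (auto simp del: norm_ge_zero)
    then show "norm (F z) \<le> (norm z / r) ^ n"
      using dil[of r "z / of_real r"] by (simp add: norm_divide)
  qed (use z in auto)
  ultimately show ?thesis
    by (intro tendsto_lowerbound[of "\<lambda>r. (norm z / r) ^ n" "norm z ^ n" "at_left 1"]) auto
qed

subsection \<open>Carlson's coefficient inequalities\<close>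

text \<open>Parseval turns a pointwise comparison on a circle into one of coefficients. Truncation
  makes the sums finite at the cost of an error \<open>e\<close>; first \<open>e\<close> tends to 0,
  then the radius to 1.\<close>

lemma power_series_Parseval_le:
  fixes c b :: "nat \<Rightarrow> complex"
  assumes g: "\<And>z. norm z < 1 \<Longrightarrow> (\<lambda>j. c j * z ^ j) sums g z"
    and le: "\<And>z. norm z < 1 \<Longrightarrow> norm (g z) \<le> norm (\<Sum>i<d. b i * z ^ i)"
  shows "(\<Sum>j<K. (norm (c j))\<^sup>2) \<le> (\<Sum>i<d. (norm (b i))\<^sup>2)"
proof -
  have circle: "(\<Sum>j<K. (norm (c j * of_real r ^ j))\<^sup>2) \<le> (\<Sum>i<d. (norm (b i))\<^sup>2)"
    if r: "0 < r" "r < 1" for r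
  proof -
    define Q where "Q z = (\<Sum>i<d. b i * z ^ i)" for z
    define A where "A = (\<Sum>i<d. norm (b i))"
    have A0: "A \<ge> 0" by (simp add: A_def sum_nonneg)
    have QA: "norm (Q z) \<le> A" if "norm z \<le> 1" for z
      unfolding Q_def A_def
      by (intro sum_norm_le) (use that in \<open>simp add: norm_mult norm_power mult_left_le power_le_one\<close>)
    have g': "\<And>z. norm z < 1 \<Longrightarrow> (\<lambda>j. z ^ j *\<^sub>C c j) sums g z"
      using g by (simp add: scaleC_complex_def mult.commute)
    \<comment> \<open>The error has this form because
      \<open>(x + e)\<^sup>2 - x\<^sup>2 = e * (2 * x + e)\<close>, with \<open>x \<le> A\<close>
      and \<open>e < 1\<close>.\<close>
    have eps: "(\<Sum>j<K. (norm (c j * of_real r ^ j))\<^sup>2) \<le> (\<Sum>i<d. (norm (b i))\<^sup>2) + e * (2 * A + 1)"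
      if e: "0 < e" "e < 1" for e
    proof -
      have "\<forall>\<^sub>F N in sequentially. \<forall>w\<in>cball 0 r. dist (\<Sum>j<N. w ^ j *\<^sub>C c j) (g w) < e"
        using uniform_limitD[OF power_series_uniform_limit[OF g' r] e(1)] by simp
      then obtain N0 where N0: "\<And>N w. N \<ge> N0 \<Longrightarrow> w \<in> cball 0 r \<Longrightarrow> dist (\<Sum>j<N. w ^ j *\<^sub>C c j) (g w) < e"
        unfolding eventually_sequentially by blast
      define N where "N = max N0 K"
      \<comment> \<open>Large enough for Parseval on both polynomials at the same points.\<close>
      define M where "M = N + d + 1"
      let ?w = "unity_root M"
      have pt: "(norm (\<Sum>j<N. (c j * of_real r ^ j) * ?w l ^ j))\<^sup>2
          \<le> (norm (\<Sum>i<d. (b i * of_real r ^ i) * ?w l ^ i))\<^sup>2 + e * (2 * A + 1)" for l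
      proof -
        define z where "z = of_real r * ?w l"
        have z: "norm z = r" using r by (simp add: z_def norm_mult)
        have 1: "(\<Sum>j<N. (c j * of_real r ^ j) * ?w l ^ j) = (\<Sum>j<N. z ^ j *\<^sub>C c j)"
          by (simp add: z_def scaleC_complex_def power_mult_distrib mult_ac)
        have 2: "(\<Sum>i<d. (b i * of_real r ^ i) * ?w l ^ i) = Q z"
          by (simp add: Q_def z_def power_mult_distrib mult_ac)
        have "norm (\<Sum>j<N. z ^ j *\<^sub>C c j) \<le> norm (g z) + e"
          using N0[of N z] z norm_triangle_sub[of "\<Sum>j<N. z ^ j *\<^sub>C c j" "g z"]
          by (simp add: N_def dist_norm)
        also have "\<dots> \<le> norm (Q z) + e" using le[of z] z r by (simp add: Q_def)
        finally have "(norm (\<Sum>j<N. z ^ j *\<^sub>C c j))\<^sup>2 \<le> (norm (Q z) + e)\<^sup>2"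
          by (intro power_mono) auto
        also have "\<dots> = (norm (Q z))\<^sup>2 + e * (2 * norm (Q z) + e)"
          by (simp add: power2_eq_square algebra_simps)
        also have "\<dots> \<le> (norm (Q z))\<^sup>2 + e * (2 * A + 1)"
          using QA[of z] z r e by (intro add_left_mono mult_left_mono) auto
        finally show ?thesis unfolding 1 2 .
      qed
      have "M * (\<Sum>j<N. (norm (c j * of_real r ^ j))\<^sup>2)
          = (\<Sum>l<M. (norm (\<Sum>j<N. (c j * of_real r ^ j) * ?w l ^ j))\<^sup>2)"
        by (rule unity_root_Parseval[symmetric]) (simp add: M_def)
      also have "\<dots> \<le> (\<Sum>l<M. (norm (\<Sum>i<d. (b i * of_real r ^ i) * ?w l ^ i))\<^sup>2 + e * (2 * A + 1))"
        by (intro sum_mono pt)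
      also have "\<dots> = M * (\<Sum>i<d. (norm (b i * of_real r ^ i))\<^sup>2) + M * (e * (2 * A + 1))"
        by (subst sum.distrib, subst unity_root_Parseval) (simp_all add: M_def)
      also have "\<dots> = M * ((\<Sum>i<d. (norm (b i * of_real r ^ i))\<^sup>2) + e * (2 * A + 1))"
        by (simp add: distrib_left)
      finally have "(\<Sum>j<N. (norm (c j * of_real r ^ j))\<^sup>2)
          \<le> (\<Sum>i<d. (norm (b i * of_real r ^ i))\<^sup>2) + e * (2 * A + 1)"
        by (rule mult_left_le_imp_le) (simp add: M_def)
      moreover have "(\<Sum>j<K. (norm (c j * of_real r ^ j))\<^sup>2) \<le> (\<Sum>j<N. (norm (c j * of_real r ^ j))\<^sup>2)"
        by (rule sum_mono2) (auto simp: N_def)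
      moreover have "(\<Sum>i<d. (norm (b i * of_real r ^ i))\<^sup>2) \<le> (\<Sum>i<d. (norm (b i))\<^sup>2)"
        using r by (intro sum_mono power_mono) (auto simp: norm_mult norm_power mult_left_le power_le_one)
      ultimately show ?thesis by linarith
    qed
    have "((\<lambda>e. (\<Sum>i<d. (norm (b i))\<^sup>2) + e * (2 * A + 1)) \<longlongrightarrow> (\<Sum>i<d. (norm (b i))\<^sup>2) + 0 * (2 * A + 1)) (at_right 0)"
      by (intro tendsto_intros)
    then show ?thesis
      by (intro tendsto_lowerbound[of _ _ "at_right (0::real)"])
        (auto intro!: eventually_at_rightI[of 0 1] eps)
  qed
  have "((\<lambda>r. \<Sum>j<K. (norm (c j * of_real r ^ j))\<^sup>2) \<longlongrightarrow> (\<Sum>j<K. (norm (c j * of_real 1 ^ j))\<^sup>2)) (at_left 1)"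
    by (intro tendsto_intros)
  then have "(\<Sum>j<K. (norm (c j * of_real 1 ^ j))\<^sup>2) \<le> (\<Sum>i<d. (norm (b i))\<^sup>2)"
    by (rule tendsto_upperbound) (auto intro!: eventually_at_leftI[of 0] circle)
  then show ?thesis by simp
qed

text \<open>The inner sums are the Taylor coefficients of \<open>g\<close> times the polynomial with
  coefficients \<open>b\<close>, which is pointwise at most that polynomial in norm. The free choice
  of \<open>b\<close> is what produces inequalities for individual \<open>a j\<close>.\<close>

lemma bounded_power_series_multiplier:
  fixes a b :: "nat \<Rightarrow> complex"
  assumes g: "\<And>z. norm z < 1 \<Longrightarrow> (\<lambda>j. a j * z ^ j) sums g z"
    and g1: "\<And>z. norm z < 1 \<Longrightarrow> norm (g z) \<le> 1"
    and b: "\<And>i. i \<ge> d \<Longrightarrow> b i = 0"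
  shows "(\<Sum>j<K. (norm (\<Sum>i\<le>j. b i * a (j - i)))\<^sup>2) \<le> (\<Sum>i<d. (norm (b i))\<^sup>2)"
proof (rule power_series_Parseval_le[where g = "\<lambda>z. (\<Sum>i<d. b i * z ^ i) * g z"])
  fix z :: complex assume z: "norm z < 1"
  have sa: "summable (\<lambda>j. norm (a j * z ^ j))"
  proof (rule powser_insidea)
    show "summable (\<lambda>n. a n * of_real ((1 + norm z) / 2) ^ n)"
      using z by (intro sums_summable[OF g]) (simp add: norm_divide flip: of_real_add)
    show "norm z < norm (complex_of_real ((1 + norm z) / 2))"
      unfolding norm_of_real using z by simp
  qed
  have sb: "summable (\<lambda>i. norm (b i * z ^ i))"
    by (rule summable_finite[of "{..<d}"]) (auto simp: b)
  have "(\<lambda>j. \<Sum>i\<le>j. (b i * z ^ i) * (a (j - i) * z ^ (j - i))) sums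
      ((\<Sum>i. b i * z ^ i) * (\<Sum>j. a j * z ^ j))"
    by (rule Cauchy_product_sums[OF sb sa])
  also have "(\<Sum>i. b i * z ^ i) = (\<Sum>i<d. b i * z ^ i)"
    by (rule suminf_finite) (auto simp: b)
  also have "(\<Sum>j. a j * z ^ j) = g z" using g[OF z] by (simp add: sums_iff)
  also have "(\<lambda>j. \<Sum>i\<le>j. (b i * z ^ i) * (a (j - i) * z ^ (j - i))) = (\<lambda>j. (\<Sum>i\<le>j. b i * a (j - i)) * z ^ j)"
  proof
    fix j
    have "(b i * z ^ i) * (a (j - i) * z ^ (j - i)) = b i * a (j - i) * z ^ j" if "i \<le> j" for i
    proof -
      have "z ^ j = z ^ i * z ^ (j - i)" using that by (simp flip: power_add)
      then show ?thesis by (simp add: mult_ac)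
    qed
    then show "(\<Sum>i\<le>j. (b i * z ^ i) * (a (j - i) * z ^ (j - i))) = (\<Sum>i\<le>j. b i * a (j - i)) * z ^ j"
      unfolding sum_distrib_right by (intro sum.cong refl) simp
  qed
  finally show "(\<lambda>j. (\<Sum>i\<le>j. b i * a (j - i)) * z ^ j) sums ((\<Sum>i<d. b i * z ^ i) * g z)" .
  show "norm ((\<Sum>i<d. b i * z ^ i) * g z) \<le> norm (\<Sum>i<d. b i * z ^ i)"
    using g1[OF z] by (simp add: norm_mult mult_left_le)
qed

lemma rotate_to_norm:
  obtains s :: complex where "norm s = 1" "s * w = of_real (norm w)"
proof (cases "w = 0")
  case True
  then show ?thesis using that[of 1] by simp
next
  case False
  show ?thesis
  proof (rule that)
    show "norm (cnj w / of_real (norm w)) = 1" using False by (simp add: norm_divide)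
    show "cnj w / of_real (norm w) * w = of_real (norm w)"
      using False complex_norm_square[of w]
      by (simp add: power2_eq_square divide_eq_eq mult.commute)
  qed
qed

text \<open>The multiplier has squared norm \<open>1 + S\<close>. In the product the indices up to
  \<open>n\<close> already contribute \<open>S\<close>, so the coefficient
  \<open>norm (a (2 * n + 1)) + S\<close> can have square at most 1.\<close>

lemma Carlson_odd:
  fixes a :: "nat \<Rightarrow> complex"
  assumes g: "\<And>z. norm z < 1 \<Longrightarrow> (\<lambda>j. a j * z ^ j) sums g z"
    and g1: "\<And>z. norm z < 1 \<Longrightarrow> norm (g z) \<le> 1"
  shows "norm (a (2 * n + 1)) \<le> 1 - (\<Sum>i\<le>n. (norm (a i))\<^sup>2)"
proof -
  define S where "S = (\<Sum>i\<le>n. (norm (a i))\<^sup>2)"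
  have S0: "S \<ge> 0" by (simp add: S_def sum_nonneg)
  obtain s where s: "norm s = 1" "s * a (2 * n + 1) = of_real (norm (a (2 * n + 1)))"
    by (rule rotate_to_norm)
  \<comment> \<open>This multiplier turns the coefficient of index \<open>2 n + 1\<close> into \<open>norm (a (2 n + 1)) + S\<close>.\<close>
  define b where "b i = (if i = 0 then s else if n < i \<and> i \<le> 2 * n + 1 then cnj (a (2 * n + 1 - i)) else 0)" for i
  define c where "c j = (\<Sum>i\<le>j. b i * a (j - i))" for j
  have reindex: "(\<Sum>i\<in>{n<..2 * n + 1}. h (2 * n + 1 - i)) = (\<Sum>i\<le>n. h i)" for h :: "nat \<Rightarrow> 'c::comm_monoid_add"
    by (rule sum.reindex_bij_witness[where i = "\<lambda>i. 2 * n + 1 - i" and j = "\<lambda>i. 2 * n + 1 - i"]) auto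
  have "(\<Sum>j<2 * n + 2. (norm (c j))\<^sup>2) \<le> (\<Sum>i<2 * n + 2. (norm (b i))\<^sup>2)"
    unfolding c_def by (rule bounded_power_series_multiplier[OF g g1]) (auto simp: b_def)
  also have "(\<Sum>i<2 * n + 2. (norm (b i))\<^sup>2) = (\<Sum>i\<in>insert 0 {n<..2 * n + 1}. (norm (b i))\<^sup>2)"
    by (rule sum.mono_neutral_right) (auto simp: b_def)
  also have "\<dots> = 1 + (\<Sum>i\<in>{n<..2 * n + 1}. (norm (a (2 * n + 1 - i)))\<^sup>2)"
    by (subst sum.insert) (auto simp: b_def s intro!: sum.cong)
  also have "\<dots> = 1 + S" unfolding reindex[of "\<lambda>i. (norm (a i))\<^sup>2"] S_def ..
  finally have le: "(\<Sum>j<2 * n + 2. (norm (c j))\<^sup>2) \<le> 1 + S" .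
  have low: "c j = s * a j" if "j \<le> n" for j
  proof -
    have "c j = (\<Sum>i\<in>{0}. b i * a (j - i))"
      unfolding c_def by (rule sum.mono_neutral_right) (use that in \<open>auto simp: b_def\<close>)
    then show ?thesis by (simp add: b_def)
  qed
  have "c (2 * n + 1) = (\<Sum>i\<in>insert 0 {n<..2 * n + 1}. b i * a (2 * n + 1 - i))"
    unfolding c_def by (rule sum.mono_neutral_right) (auto simp: b_def)
  also have "\<dots> = s * a (2 * n + 1) + (\<Sum>i\<in>{n<..2 * n + 1}. of_real ((norm (a (2 * n + 1 - i)))\<^sup>2))"
    by (subst sum.insert) (auto simp: b_def complex_norm_square mult.commute simp del: of_real_power intro!: sum.cong)
  also have "\<dots> = of_real (norm (a (2 * n + 1)) + S)"
    unfolding reindex[of "\<lambda>i. complex_of_real ((norm (a i))\<^sup>2)"] s S_def by simp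
  finally have top: "norm (c (2 * n + 1)) = norm (a (2 * n + 1)) + S"
    using S0 by (simp only: norm_of_real) simp
  have "S + (norm (a (2 * n + 1)) + S)\<^sup>2 = (\<Sum>j\<in>insert (2 * n + 1) {..n}. (norm (c j))\<^sup>2)"
    by (subst sum.insert) (auto simp: low norm_mult s S_def top[simplified] top)
  also have "\<dots> \<le> (\<Sum>j<2 * n + 2. (norm (c j))\<^sup>2)"
    by (rule sum_mono2) auto
  finally have "(norm (a (2 * n + 1)) + S)\<^sup>2 \<le> 1" using le by linarith
  then have "norm (a (2 * n + 1)) + S \<le> 1" using S0 by (simp add: power2_le_iff_abs_le abs_square_le_1)
  then show ?thesis by (simp add: S_def)
qed

text \<open>As in the odd case, but now the index \<open>n\<close> is its own mirror image in
  \<open>2 * n\<close>. Its coefficient occurs both in the multiplier and, perturbed by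
  \<open>a 0\<close>, in the product; balancing the two is the origin of
  \<open>1 + norm (a 0)\<close>.\<close>

lemma Carlson_even:
  fixes a :: "nat \<Rightarrow> complex"
  assumes g: "\<And>z. norm z < 1 \<Longrightarrow> (\<lambda>j. a j * z ^ j) sums g z"
    and g1: "\<And>z. norm z < 1 \<Longrightarrow> norm (g z) \<le> 1" and n: "n \<ge> 1"
  shows "norm (a (2 * n)) \<le> 1 - (\<Sum>i<n. (norm (a i))\<^sup>2) - (norm (a n))\<^sup>2 / (1 + norm (a 0))"
proof -
  define S where "S = (\<Sum>i<n. (norm (a i))\<^sup>2)"
  \<comment> \<open>The solution of \<open>1 - t norm (a 0) = t\<close>: it makes the terms of index \<open>n\<close> on both sides cancel.\<close>
  define t where "t = 1 / (1 + norm (a 0))"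
  have S0: "S \<ge> 0" by (simp add: S_def sum_nonneg)
  have t0: "t > 0" by (simp add: t_def add_pos_nonneg)
  have t1: "1 - t * norm (a 0) = t"
  proof -
    have "1 + norm (a 0) \<noteq> 0" using norm_ge_zero[of "a 0"] by linarith
    then show ?thesis by (simp add: t_def field_simps)
  qed
  obtain s where s: "norm s = 1" "s * a (2 * n) = of_real (norm (a (2 * n)))"
    by (rule rotate_to_norm)
  define b where "b i = (if i = 0 then s else if i = n then of_real t * cnj (a n)
      else if n < i \<and> i \<le> 2 * n then cnj (a (2 * n - i)) else 0)" for i
  define c where "c j = (\<Sum>i\<le>j. b i * a (j - i))" for j
  have reindex: "(\<Sum>i\<in>{n<..2 * n}. h (2 * n - i)) = (\<Sum>i<n. h i)" for h :: "nat \<Rightarrow> 'c::comm_monoid_add"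
    by (rule sum.reindex_bij_witness[where i = "\<lambda>i. 2 * n - i" and j = "\<lambda>i. 2 * n - i"]) auto
  have "(\<Sum>j<2 * n + 1. (norm (c j))\<^sup>2) \<le> (\<Sum>i<2 * n + 1. (norm (b i))\<^sup>2)"
    unfolding c_def by (rule bounded_power_series_multiplier[OF g g1]) (use n in \<open>auto simp: b_def\<close>)
  also have "(\<Sum>i<2 * n + 1. (norm (b i))\<^sup>2) = (\<Sum>i\<in>insert 0 (insert n {n<..2 * n}). (norm (b i))\<^sup>2)"
    by (rule sum.mono_neutral_right) (auto simp: b_def)
  also have "\<dots> = 1 + (t\<^sup>2 * (norm (a n))\<^sup>2 + (\<Sum>i\<in>{n<..2 * n}. (norm (a (2 * n - i)))\<^sup>2))"
    using n t0 by (simp add: b_def s norm_mult power_mult_distrib)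
  also have "\<dots> = 1 + t\<^sup>2 * (norm (a n))\<^sup>2 + S" by (simp add: reindex[of "\<lambda>i. (norm (a i))\<^sup>2"] S_def)
  finally have le: "(\<Sum>j<2 * n + 1. (norm (c j))\<^sup>2) \<le> 1 + t\<^sup>2 * (norm (a n))\<^sup>2 + S" .
  have low: "c j = s * a j" if "j < n" for j
  proof -
    have "c j = (\<Sum>i\<in>{0}. b i * a (j - i))"
      unfolding c_def by (rule sum.mono_neutral_right) (use that in \<open>auto simp: b_def\<close>)
    then show ?thesis by (simp add: b_def)
  qed
  have "c n = (\<Sum>i\<in>{0, n}. b i * a (n - i))"
    unfolding c_def by (rule sum.mono_neutral_right) (auto simp: b_def)
  also have "\<dots> = s * a n + of_real t * cnj (a n) * a 0"
    using n by (simp add: b_def)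
  finally have cn: "c n = s * a n + of_real t * cnj (a n) * a 0" .
  have "t * norm (a n) = norm (s * a n) - norm (of_real t * cnj (a n) * a 0)"
    using t0 by (subst t1[symmetric]) (simp add: norm_mult s algebra_simps)
  also have "\<dots> \<le> norm (c n)" unfolding cn by (rule norm_diff_ineq)
  finally have mid: "t\<^sup>2 * (norm (a n))\<^sup>2 \<le> (norm (c n))\<^sup>2"
    using t0 power_mono[of "t * norm (a n)" "norm (c n)" 2] by (simp add: power_mult_distrib)
  have "c (2 * n) = (\<Sum>i\<in>insert 0 (insert n {n<..2 * n}). b i * a (2 * n - i))"
    unfolding c_def by (rule sum.mono_neutral_right) (auto simp: b_def)
  also have "\<dots> = s * a (2 * n) + (of_real t * (cnj (a n) * a n) + (\<Sum>i\<in>{n<..2 * n}. of_real ((norm (a (2 * n - i)))\<^sup>2)))"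
    using n by (simp add: b_def complex_norm_square mult.commute mult.left_commute mult_2 del: of_real_power)
  also have "\<dots> = of_real (norm (a (2 * n)) + t * (norm (a n))\<^sup>2 + S)"
    unfolding reindex[of "\<lambda>i. complex_of_real ((norm (a i))\<^sup>2)"] s S_def
    by (simp add: complex_norm_square mult.commute del: of_real_power)
  finally have top: "norm (c (2 * n)) = norm (a (2 * n)) + t * (norm (a n))\<^sup>2 + S"
    using S0 t0 by (simp only: norm_of_real) simp
  have "S + t\<^sup>2 * (norm (a n))\<^sup>2 + (norm (a (2 * n)) + t * (norm (a n))\<^sup>2 + S)\<^sup>2
      \<le> S + (norm (c n))\<^sup>2 + (norm (c (2 * n)))\<^sup>2"
    using mid unfolding top by linarith
  also have "\<dots> = (\<Sum>j\<in>insert (2 * n) (insert n {..<n}). (norm (c j))\<^sup>2)"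
    using n by (simp add: low norm_mult s S_def)
  also have "\<dots> \<le> (\<Sum>j<2 * n + 1. (norm (c j))\<^sup>2)"
    by (rule sum_mono2) auto
  finally have "(norm (a (2 * n)) + t * (norm (a n))\<^sup>2 + S)\<^sup>2 \<le> 1" using le by linarith
  then have "norm (a (2 * n)) + t * (norm (a n))\<^sup>2 + S \<le> 1"
    using abs_square_le_1 abs_le_D1 by blast
  then show ?thesis by (simp add: S_def t_def)
qed

text \<open>The partial sums telescope: Carlson's inequalities bound the terms of index \<open>2 n + 1\<close>
  and \<open>2 n + 2\<close>, and the squared terms of the sum compensate the losses exactly.\<close>

lemma Bohr_area_partial_sum:
  fixes a :: "nat \<Rightarrow> complex"
  assumes g: "\<And>z. norm z < 1 \<Longrightarrow> (\<lambda>j. a j * z ^ j) sums g z"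
    and g1: "\<And>z. norm z < 1 \<Longrightarrow> norm (g z) \<le> 1" and r: "0 \<le> r" "r < 1"
  shows "(\<Sum>j<2 * N. norm (a (Suc j)) * r ^ Suc j)
      + (1 / (1 + norm (a 0)) + r / (1 - r)) * (\<Sum>j<N. (norm (a (Suc j)) * r ^ Suc j)\<^sup>2)
    \<le> (1 - (norm (a 0))\<^sup>2) * (r / (1 - r)) - (1 - (\<Sum>i\<le>N. (norm (a i))\<^sup>2)) * (r ^ (2 * N + 1) / (1 - r))"
proof (induction N)
  case (Suc N)
  define S where "S = (\<Sum>i\<le>N. (norm (a i))\<^sup>2)"
  define x where "x = (norm (a (Suc N)))\<^sup>2"
  define q where "q = r ^ (2 * N + 1)"
  have "(r ^ Suc N)\<^sup>2 = q * r"
    unfolding q_def power_Suc2[symmetric] power_mult[symmetric] by (rule arg_cong) simp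
  then have xq: "(norm (a (Suc N)) * r ^ Suc N)\<^sup>2 = x * (q * r)"
    by (simp only: x_def power_mult_distrib)
  have "norm (a (2 * N + 1)) * q \<le> (1 - S) * q"
    using Carlson_odd[OF g g1, of N] r by (intro mult_right_mono) (auto simp: S_def q_def)
  moreover have "norm (a (2 * N + 2)) * (q * r) \<le> (1 - S - x / (1 + norm (a 0))) * (q * r)"
    using Carlson_even[OF g g1, of "Suc N"] r
    by (intro mult_right_mono) (auto simp: S_def q_def x_def lessThan_Suc_atMost)
  moreover have e1: "(\<Sum>j<2 * Suc N. norm (a (Suc j)) * r ^ Suc j) = (\<Sum>j<2 * N. norm (a (Suc j)) * r ^ Suc j)
      + norm (a (2 * N + 1)) * q + norm (a (2 * N + 2)) * (q * r)"
    by (simp add: q_def mult_ac)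
  moreover have e2: "(1 / (1 + norm (a 0)) + r / (1 - r)) * (\<Sum>j<Suc N. (norm (a (Suc j)) * r ^ Suc j)\<^sup>2)
      = (1 / (1 + norm (a 0)) + r / (1 - r)) * (\<Sum>j<N. (norm (a (Suc j)) * r ^ Suc j)\<^sup>2)
        + x / (1 + norm (a 0)) * (q * r) + r / (1 - r) * (x * (q * r))"
    unfolding sum.lessThan_Suc xq by (simp add: distrib_left distrib_right)
  \<comment> \<open>The tail \<open>q / (1 - r)\<close> loses its first two terms \<open>q\<close>
    and \<open>q * r\<close>, and the extra square turns \<open>S\<close> into \<open>S + x\<close>:
    this is the remainder for \<open>Suc N\<close>.\<close>
  moreover have "(1 - S) * q + (1 - S) * (q * r) + r / (1 - r) * (x * (q * r)) - (1 - S) * (q / (1 - r))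
      = - ((1 - (S + x)) * (q * r * r / (1 - r)))"
    using r by (simp add: divide_simps) (simp add: algebra_simps)
  moreover have "(1 - S - x / (1 + norm (a 0))) * (q * r) = (1 - S) * (q * r) - x / (1 + norm (a 0)) * (q * r)"
    by (rule left_diff_distrib)
  moreover have e3: "(\<Sum>i\<le>Suc N. (norm (a i))\<^sup>2) = S + x" by (simp add: S_def x_def)
  moreover have e4: "r ^ (2 * Suc N + 1) = q * r * r" by (simp add: q_def)
  ultimately show ?case
    using Suc.IH unfolding e1 e2 e3 e4 S_def[symmetric] q_def[symmetric] times_divide_eq_right by linarith
qed simp

lemma bounded_power_series_Bohr_area:
  fixes a :: "nat \<Rightarrow> complex"
  assumes g: "\<And>z. norm z < 1 \<Longrightarrow> (\<lambda>j. a j * z ^ j) sums g z"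
    and g1: "\<And>z. norm z < 1 \<Longrightarrow> norm (g z) \<le> 1" and r: "0 \<le> r" "r < 1"
  shows "summable (\<lambda>j. norm (a (Suc j)) * r ^ Suc j)"
    and "summable (\<lambda>j. (norm (a (Suc j)) * r ^ Suc j)\<^sup>2)"
    and "(\<Sum>j. norm (a (Suc j)) * r ^ Suc j)
      + (1 / (1 + norm (a 0)) + r / (1 - r)) * (\<Sum>j. (norm (a (Suc j)) * r ^ Suc j)\<^sup>2)
    \<le> (1 - (norm (a 0))\<^sup>2) * (r / (1 - r))"
proof -
  define B where "B = (1 - (norm (a 0))\<^sup>2) * (r / (1 - r))"
  define K where "K = 1 / (1 + norm (a 0)) + r / (1 - r)"
  have K: "K > 0" using r by (auto simp: K_def intro!: add_pos_nonneg)
  have part: "(\<Sum>j<2 * N. norm (a (Suc j)) * r ^ Suc j) + K * (\<Sum>j<N. (norm (a (Suc j)) * r ^ Suc j)\<^sup>2) \<le> B" for N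
  proof -
    have "(\<Sum>i\<le>N. (norm (a i))\<^sup>2) \<le> 1"
      using Carlson_odd[OF g g1, of N] norm_ge_zero[of "a (2 * N + 1)"] by linarith
    then have "(1 - (\<Sum>i\<le>N. (norm (a i))\<^sup>2)) * (r ^ (2 * N + 1) / (1 - r)) \<ge> 0"
      using r by (intro mult_nonneg_nonneg) auto
    then show ?thesis using Bohr_area_partial_sum[OF g g1 r, of N] unfolding B_def K_def by linarith
  qed
  have nn: "0 \<le> norm (a (Suc j)) * r ^ Suc j" for j using r by simp
  show s1: "summable (\<lambda>j. norm (a (Suc j)) * r ^ Suc j)"
  proof (rule bounded_imp_summable[OF nn])
    fix N
    have "(\<Sum>j\<le>N. norm (a (Suc j)) * r ^ Suc j) \<le> (\<Sum>j<2 * Suc N. norm (a (Suc j)) * r ^ Suc j)"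
      by (rule sum_mono2) (use r in auto)
    also have "\<dots> \<le> B"
      using part[of "Suc N"] mult_nonneg_nonneg[OF less_imp_le[OF K] sum_nonneg[of "{..<Suc N}" "\<lambda>j. (norm (a (Suc j)) * r ^ Suc j)\<^sup>2"]]
      by auto
    finally show "(\<Sum>j\<le>N. norm (a (Suc j)) * r ^ Suc j) \<le> B" .
  qed
  show s2: "summable (\<lambda>j. (norm (a (Suc j)) * r ^ Suc j)\<^sup>2)"
  proof (rule bounded_imp_summable)
    fix N
    have "K * (\<Sum>j<Suc N. (norm (a (Suc j)) * r ^ Suc j)\<^sup>2) \<le> B"
      using part[of "Suc N"] sum_nonneg[of "{..<2 * Suc N}" "\<lambda>j. norm (a (Suc j)) * r ^ Suc j"] nn by fastforce
    then show "(\<Sum>j\<le>N. (norm (a (Suc j)) * r ^ Suc j)\<^sup>2) \<le> B / K"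
      using K by (simp add: field_simps lessThan_Suc_atMost)
  qed simp
  have "(\<lambda>N. (\<Sum>j<2 * N. norm (a (Suc j)) * r ^ Suc j) + K * (\<Sum>j<N. (norm (a (Suc j)) * r ^ Suc j)\<^sup>2))
      \<longlonglongrightarrow> (\<Sum>j. norm (a (Suc j)) * r ^ Suc j) + K * (\<Sum>j. (norm (a (Suc j)) * r ^ Suc j)\<^sup>2)"
    by (intro tendsto_intros summable_LIMSEQ s2
        filterlim_compose[OF summable_LIMSEQ[OF s1]] filterlim_subseq strict_monoI) auto
  then have "(\<Sum>j. norm (a (Suc j)) * r ^ Suc j) + K * (\<Sum>j. (norm (a (Suc j)) * r ^ Suc j)\<^sup>2) \<le> B"
    by (rule LIMSEQ_le_const2) (use part in auto)
  then show "(\<Sum>j. norm (a (Suc j)) * r ^ Suc j)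
      + (1 / (1 + norm (a 0)) + r / (1 - r)) * (\<Sum>j. (norm (a (Suc j)) * r ^ Suc j)\<^sup>2)
    \<le> (1 - (norm (a 0))\<^sup>2) * (r / (1 - r))" by (simp add: B_def K_def)
qed

subsection \<open>Norming functionals\<close>

definition sublinear_functional :: "('a::real_vector \<Rightarrow> real) \<Rightarrow> bool" where
  "sublinear_functional q \<longleftrightarrow>
     (\<forall>x y. q (x + y) \<le> q x + q y) \<and> (\<forall>c x. 0 \<le> c \<longrightarrow> q (c *\<^sub>R x) = c * q x)"

text \<open>The opposite inequality for a positive factor follows by applying \<open>pos\<close> to
  \<open>inverse c\<close> and \<open>c *\<^sub>R x\<close>.\<close>

lemma sublinear_functionalI:
  assumes sub: "\<And>x y. q (x + y) \<le> q x + q y" and zero: "q 0 = 0"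
    and pos: "\<And>c x. 0 < c \<Longrightarrow> q (c *\<^sub>R x) \<le> c * q x"
  shows "sublinear_functional q"
proof -
  have "q (c *\<^sub>R x) = c * q x" if c: "0 < c" for c x
  proof (rule antisym[OF pos[OF c]])
    have "c * q x = c * q (inverse c *\<^sub>R (c *\<^sub>R x))" using c by simp
    also have "\<dots> \<le> c * (inverse c * q (c *\<^sub>R x))" using c by (intro mult_left_mono pos) auto
    also have "\<dots> = q (c *\<^sub>R x)" using c by simp
    finally show "c * q x \<le> q (c *\<^sub>R x)" .
  qed
  then show ?thesis
    using sub zero by (auto simp: sublinear_functional_def le_less)
qed

lemma sublinear_functionalD:
  assumes "sublinear_functional q"
  shows "q (x + y) \<le> q x + q y" "0 \<le> c \<Longrightarrow> q (c *\<^sub>R x) = c * q x" "q 0 = 0" "- q (- x) \<le> q x"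
proof -
  show 1: "q (x + y) \<le> q x + q y" for x y using assms by (simp add: sublinear_functional_def)
  show "0 \<le> c \<Longrightarrow> q (c *\<^sub>R x) = c * q x" using assms by (simp add: sublinear_functional_def)
  have "q (0 *\<^sub>R 0) = 0 * q 0" using assms unfolding sublinear_functional_def by blast
  then show 0: "q 0 = 0" by simp
  show "- q (- x) \<le> q x" using 1[of x "- x"] 0 by simp
qed

text \<open>The infimum makes \<open>q'\<close> as small as possible in the direction
  \<open>- y\<close>; \<open>t = 1\<close> gives the last claim. It serves twice: a minimal
  functional must be odd, and decreasing the norm along a unit vector \<open>e\<close> forces every
  linear functional below the result to be at least 1 at \<open>e\<close>.\<close>

lemma sublinear_functional_decrease:
  assumes q: "sublinear_functional q"
  obtains q' where "sublinear_functional q'" "\<And>x. q' x \<le> q x" "q' (- y) \<le> - q y"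
proof -
  note qD = sublinear_functionalD[OF q]
  define q' where "q' x = (INF t\<in>{0..}. q (x + t *\<^sub>R y) - t * q y)" for x
  have lower: "- q (- x) \<le> q (x + t *\<^sub>R y) - t * q y" if "0 \<le> t" for x t
    using qD(1)[of "x + t *\<^sub>R y" "- x"] qD(2)[OF that, of y] by simp
  have bdd: "bdd_below ((\<lambda>t. q (x + t *\<^sub>R y) - t * q y) ` {0..})" for x
    by (rule bdd_belowI2[where m = "- q (- x)"]) (simp add: lower)
  have le: "q' x \<le> q (x + t *\<^sub>R y) - t * q y" if "0 \<le> t" for x t
    unfolding q'_def by (rule cINF_lower[OF bdd]) (use that in simp)
  have ge: "b \<le> q' x" if "\<And>t. 0 \<le> t \<Longrightarrow> b \<le> q (x + t *\<^sub>R y) - t * q y" for b x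
    unfolding q'_def by (rule cINF_greatest) (use that in auto)
  show ?thesis
  proof
    show "q' x \<le> q x" for x using le[of 0 x] by simp
    show "q' (- y) \<le> - q y" using le[of 1 "- y"] qD(3) by simp
    show "sublinear_functional q'"
    proof (rule sublinear_functionalI)
      fix x1 x2
      have "q' (x1 + x2) \<le> (q (x1 + t1 *\<^sub>R y) - t1 * q y) + (q (x2 + t2 *\<^sub>R y) - t2 * q y)"
        if "0 \<le> t1" "0 \<le> t2" for t1 t2
        using le[of "t1 + t2" "x1 + x2"] qD(1)[of "x1 + t1 *\<^sub>R y" "x2 + t2 *\<^sub>R y"] that
        by (simp add: algebra_simps)
      then have "q' (x1 + x2) - (q (x2 + t2 *\<^sub>R y) - t2 * q y) \<le> q' x1" if "0 \<le> t2" for t2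
        by (intro ge) (use that in \<open>simp add: algebra_simps\<close>)
      then have "q' (x1 + x2) - q' x1 \<le> q' x2"
        by (intro ge) (simp add: algebra_simps)
      then show "q' (x1 + x2) \<le> q' x1 + q' x2" by simp
    next
      show "q' 0 = 0"
        using le[of 0 0] ge[of 0 0] lower[of _ 0] qD(3) by (intro antisym) auto
    next
      fix c :: real and x assume c: "0 < c"
      have "q' (c *\<^sub>R x) / c \<le> q' x"
      proof (rule ge)
        fix t :: real assume t: "0 \<le> t"
        have "q' (c *\<^sub>R x) \<le> q (c *\<^sub>R (x + t *\<^sub>R y)) - c * t * q y"
          using le[of "c * t" "c *\<^sub>R x"] c t by (simp add: algebra_simps)
        also have "\<dots> = c * (q (x + t *\<^sub>R y) - t * q y)"
          using qD(2)[of c "x + t *\<^sub>R y"] c by (simp add: right_diff_distrib)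
        finally show "q' (c *\<^sub>R x) / c \<le> q (x + t *\<^sub>R y) - t * q y"
          using c by (simp add: divide_le_eq mult.commute)
      qed
      then show "q' (c *\<^sub>R x) \<le> c * q' x" using c by (simp add: divide_le_eq mult.commute)
    qed
  qed
qed

text \<open>A minimal sublinear functional below \<open>p\<close>, which Zorn's lemma provides, cannot be decreased
  further and is therefore odd, hence linear.\<close>

lemma sublinear_functional_dominates_linear:
  assumes p: "sublinear_functional (p :: 'a::real_vector \<Rightarrow> real)"
  obtains m where "linear m" "\<And>x. m x \<le> p x"
proof -
  define A where "A = {q. sublinear_functional q \<and> (\<forall>x. q x \<le> p x)}"
  \<comment> \<open>The order is reversed, so the maximal element from Zorn's lemma is a minimal
    functional.\<close>
  define R where "R q1 q2 \<longleftrightarrow> (\<forall>x. q2 x \<le> q1 x)" for q1 q2 :: "'a \<Rightarrow> real"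
  have po: "partial_order_on A (relation_of R A)"
    by (rule partial_order_on_relation_ofI) (auto simp: R_def fun_eq_iff intro: order_trans antisym)
  have chain: "\<exists>u\<in>A. \<forall>q\<in>C. R q u" if C: "C \<in> Chains (relation_of R A)" for C
  proof (cases "C = {}")
    case True
    then show ?thesis using p by (auto simp: A_def)
  next
    case False
    have CA: "C \<subseteq> A" and tot: "\<And>q1 q2. q1 \<in> C \<Longrightarrow> q2 \<in> C \<Longrightarrow> R q1 q2 \<or> R q2 q1"
      using C by (auto simp: Chains_def relation_of_def)
    define u where "u x = (INF q\<in>C. q x)" for x
    have bdd: "bdd_below ((\<lambda>q. q x) ` C)" for x
    proof (rule bdd_belowI2[where m = "- p (- x)"])
      fix q assume "q \<in> C"
      then have "sublinear_functional q" "q (- x) \<le> p (- x)" using CA by (auto simp: A_def)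
      then show "- p (- x) \<le> q x" using sublinear_functionalD(4)[of q x] by linarith
    qed
    have le: "u x \<le> q x" if "q \<in> C" for q x
      unfolding u_def by (rule cINF_lower[OF bdd that])
    have ge: "b \<le> u x" if "\<And>q. q \<in> C \<Longrightarrow> b \<le> q x" for b x
      unfolding u_def by (rule cINF_greatest[OF False]) (use that in auto)
    have sl: "sublinear_functional q" if "q \<in> C" for q using that CA by (auto simp: A_def)
    have "sublinear_functional u"
    proof (rule sublinear_functionalI)
      fix x y
      \<comment> \<open>Members of a chain are comparable, so the subadditivity of the smaller one
        bounds both terms.\<close>
      have "u (x + y) \<le> q1 x + q2 y" if q: "q1 \<in> C" "q2 \<in> C" for q1 q2
        using tot[OF q]
      proof
        assume "R q1 q2"
        then show ?thesis
          using le[OF q(2), of "x + y"] sublinear_functionalD(1)[OF sl[OF q(2)], of x y]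
          by (auto simp: R_def intro: order_trans dest: spec[of _ x])
      next
        assume "R q2 q1"
        then show ?thesis
          using le[OF q(1), of "x + y"] sublinear_functionalD(1)[OF sl[OF q(1)], of x y]
          by (auto simp: R_def intro: order_trans dest: spec[of _ y])
      qed
      then have "u (x + y) - q2 y \<le> u x" if "q2 \<in> C" for q2
        by (intro ge) (use that in \<open>simp add: algebra_simps\<close>)
      then have "u (x + y) - u x \<le> u y" by (intro ge) (simp add: algebra_simps)
      then show "u (x + y) \<le> u x + u y" by simp
    next
      have zero: "q 0 = 0" if "q \<in> C" for q using sublinear_functionalD(3)[OF sl[OF that]] .
      obtain q where "q \<in> C" using False by blast
      then have "u 0 \<le> 0" using le[of q 0] zero[of q] by simp
      moreover have "0 \<le> u 0" by (rule ge) (simp add: zero)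
      ultimately show "u 0 = 0" by simp
    next
      fix c :: real and x assume c: "0 < c"
      have "u (c *\<^sub>R x) / c \<le> u x"
        by (rule ge) (use le[of _ "c *\<^sub>R x"] sublinear_functionalD(2)[OF sl, of _ c x] c in
          \<open>force simp: divide_le_eq mult.commute\<close>)
      then show "u (c *\<^sub>R x) \<le> c * u x" using c by (simp add: divide_le_eq mult.commute)
    qed
    moreover have "u x \<le> p x" for x
      using False CA le by (force simp: A_def intro: order_trans)
    ultimately show ?thesis using le by (auto simp: A_def R_def)
  qed
  obtain m where m: "m \<in> A" and min: "\<And>q. q \<in> A \<Longrightarrow> R m q \<Longrightarrow> q = m"
    using predicate_Zorn[OF po chain] by blast
  have sm: "sublinear_functional m" using m by (simp add: A_def)
  note mD = sublinear_functionalD[OF sm]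
  have odd: "m (- y) = - m y" for y
  proof -
    obtain q' where q': "sublinear_functional q'" "\<And>x. q' x \<le> m x" "q' (- y) \<le> - m y"
      using sublinear_functional_decrease[OF sm] by blast
    have "q' \<in> A" using q'(1,2) m by (force simp: A_def intro: order_trans)
    then have "q' = m" using q'(2) by (intro min) (auto simp: R_def)
    then show ?thesis using q'(3) mD(4)[of y] by auto
  qed
  have "linear m"
  proof (rule linearI)
    fix x y
    show "m (x + y) = m x + m y"
      using mD(1)[of x y] mD(1)[of "- x" "- y"] odd[of x] odd[of y] odd[of "x + y"] by simp
  next
    fix c :: real and x
    show "m (c *\<^sub>R x) = c *\<^sub>R m x"
      using mD(2)[of c x] mD(2)[of "- c" x] odd[of "c *\<^sub>R x"] by (cases "0 \<le> c") auto
  qed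
  then show ?thesis using that m by (auto simp: A_def)
qed

locale complex_functional =
  fixes l :: "'a::complex_normed_vector \<Rightarrow> complex"
  assumes add: "l (x + y) = l x + l y" and scaleC: "l (c *\<^sub>C x) = c * l x"
    and norm_le: "norm (l x) \<le> norm x"

text \<open>\<open>l\<close> is the usual complexification of a real functional \<open>m\<close>
  below the norm, with real part \<open>m\<close>. Rotating the argument carries the bound from
  \<open>m\<close> to \<open>l\<close>. At \<open>e\<close> the real part is at least 1 and the
  modulus at most 1, which leaves the value 1.\<close>

lemma norming_functional:
  fixes e :: "'a::complex_normed_vector"
  assumes e: "norm e = 1"
  obtains l :: "'a \<Rightarrow> complex" where "complex_functional l" "l e = 1"
proof -
  have "sublinear_functional (norm :: 'a \<Rightarrow> real)"
    by (rule sublinear_functionalI) (auto simp: norm_triangle_ineq)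
  then obtain p where p: "sublinear_functional p" "\<And>x::'a. p x \<le> norm x" "p (- e) \<le> - norm e"
    using sublinear_functional_decrease by blast
  obtain m where m: "linear m" "\<And>x. m x \<le> p x"
    using sublinear_functional_dominates_linear[OF p(1)] by blast
  have mle: "m x \<le> norm x" for x using m(2) p(2) order_trans by blast
  have me: "1 \<le> m e" using m(2)[of "- e"] p(3) e linear_neg[OF m(1), of e] by simp
  define l where "l x = complex_of_real (m x) - \<i> * complex_of_real (m (\<i> *\<^sub>C x))" for x
  have add: "l (x + y) = l x + l y" for x y
    by (simp add: l_def linear_add[OF m(1)] scaleC_add_right algebra_simps)
  have scale: "l (c *\<^sub>C x) = c * l x" for c x
  proof -
    have c: "c = of_real (Re c) + \<i> * of_real (Im c)" by (rule complex_eq)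
    have 1: "c *\<^sub>C x = Re c *\<^sub>R x + Im c *\<^sub>R (\<i> *\<^sub>C x)"
      by (subst c) (simp add: scaleC_add_left scaleR_scaleC mult.commute scaleC_of_real)
    have "\<i> * c = of_real (- Im c) + of_real (Re c) * \<i>" by (simp add: complex_eq_iff)
    then have 2: "\<i> *\<^sub>C (c *\<^sub>C x) = (- Im c) *\<^sub>R x + Re c *\<^sub>R (\<i> *\<^sub>C x)"
      by (simp only: scaleC_scaleC scaleC_add_left scaleR_scaleC scaleC_of_real)
    have "l (c *\<^sub>C x) = of_real (Re c * m x + Im c * m (\<i> *\<^sub>C x))
        - \<i> * of_real (- Im c * m x + Re c * m (\<i> *\<^sub>C x))"
      unfolding l_def 2 unfolding 1 by (simp only: linear_add[OF m(1)] linear_cmul[OF m(1)] real_scaleR_def)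
    also have "\<dots> = c * l x" by (simp add: complex_eq_iff l_def)
    finally show ?thesis .
  qed
  have norm: "norm (l x) \<le> norm x" for x
  proof -
    obtain s where s: "norm s = 1" "s * l x = of_real (norm (l x))" by (rule rotate_to_norm)
    have "norm (l x) = Re (l (s *\<^sub>C x))" unfolding scale s(2) by simp
    also have "\<dots> = m (s *\<^sub>C x)" by (simp add: l_def)
    also have "\<dots> \<le> norm (s *\<^sub>C x)" by (rule mle)
    also have "\<dots> = norm x" by (simp add: norm_scaleC s)
    finally show ?thesis .
  qed
  have "l e = 1"
  proof -
    have re: "Re (l e) \<ge> 1" using me by (simp add: l_def)
    have "(Re (l e))\<^sup>2 + (Im (l e))\<^sup>2 \<le> 1"
      using norm[of e] e power_mono[of "norm (l e)" 1 2] by (simp add: cmod_power2)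
    moreover have "(Re (l e))\<^sup>2 \<ge> Re (l e)" using re by (simp add: power2_eq_square)
    ultimately have "Re (l e) = 1" "(Im (l e))\<^sup>2 = 0"
      using re zero_le_power2[of "Im (l e)"] by linarith+
    then show ?thesis by (simp add: complex_eq_iff)
  qed
  moreover have "complex_functional l" by standard (rule add scale norm)+
  ultimately show ?thesis using that by blast
qed

subsection \<open>The Schwarz--Pick bound and the Bohr root\<close>

text \<open>The Schwarz lemma for the Moebius transform of \<open>g\<close> bounds the
  pseudohyperbolic distance of \<open>g z\<close> and \<open>g 0\<close> by \<open>norm z\<close>;
  what remains is to pass to moduli.\<close>

lemma bounded_power_series_Schwarz_Pick:
  fixes a :: "nat \<Rightarrow> complex"
  assumes g: "\<And>z. norm z < 1 \<Longrightarrow> (\<lambda>j. a j * z ^ j) sums g z"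
    and g1: "\<And>z. norm z < 1 \<Longrightarrow> norm (g z) < 1" and z: "norm z < 1"
  shows "norm (g z) \<le> (norm (g 0) + norm z) / (1 + norm (g 0) * norm z)"
proof -
  define h where "h = Moebius_function 0 (g 0) \<circ> g"
  have g0: "norm (g 0) < 1" by (simp add: g1)
  have holg: "g holomorphic_on ball 0 1"
    by (rule power_series_holomorphic[where a = a]) (simp add: g)
  have "h holomorphic_on ball 0 1"
    unfolding h_def
    by (rule holomorphic_on_compose_gen[OF holg Moebius_function_holomorphic[OF g0]]) (auto simp: g1)
  moreover have "h 0 = 0" by (simp add: h_def Moebius_function_eq_zero)
  moreover have "norm (h w) < 1" if "norm w < 1" for w
    using that by (simp add: h_def Moebius_function_norm_lt_1 g0 g1)
  ultimately have hz: "norm (h z) \<le> norm z" using z by (intro Schwarz_Lemma(1))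
  define A x t R where "A = norm (g 0)" and "x = norm (g z)" and "t = norm z" and "R = Re (cnj (g 0) * g z)"
  have ranges: "0 \<le> A" "A < 1" "0 \<le> x" "x < 1" "0 \<le> t" "t < 1"
    using g0 g1[OF z] z by (auto simp: A_def x_def t_def)
  have ne: "1 - cnj (g 0) * g z \<noteq> 0"
  proof
    assume "1 - cnj (g 0) * g z = 0"
    then have "norm (cnj (g 0) * g z) = 1" by simp
    then have "A * x = 1" by (simp add: norm_mult A_def x_def)
    moreover have "A * x < 1" using ranges mult_left_le[of x A] by linarith
    ultimately show False by simp
  qed
  have "norm (g z - g 0) \<le> t * norm (1 - cnj (g 0) * g z)"
    using hz ne by (simp add: h_def Moebius_function_simple norm_divide t_def divide_le_eq)
  then have "(norm (g z - g 0))\<^sup>2 \<le> (t * norm (1 - cnj (g 0) * g z))\<^sup>2" by (intro power_mono) auto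
  moreover have "(norm (g z - g 0))\<^sup>2 = x\<^sup>2 + A\<^sup>2 - 2 * R"
    unfolding x_def A_def R_def cmod_power2 by (simp add: power2_eq_square algebra_simps)
  moreover have "(norm (1 - cnj (g 0) * g z))\<^sup>2 = 1 + A\<^sup>2 * x\<^sup>2 - 2 * R"
    unfolding x_def A_def R_def cmod_power2 by (simp add: power2_eq_square algebra_simps)
  ultimately have 1: "x\<^sup>2 + A\<^sup>2 - 2 * R \<le> t\<^sup>2 * (1 + A\<^sup>2 * x\<^sup>2 - 2 * R)"
    by (simp add: power_mult_distrib)
  \<comment> \<open>After collecting terms \<open>R\<close> carries the factor
    \<open>1 - t\<^sup>2 \<ge> 0\<close>, so it may be raised to \<open>A * x\<close>, the case of
    equal arguments. Both sides then become squares.\<close>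
  have "R \<le> A * x"
    using complex_Re_le_cmod[of "cnj (g 0) * g z"] by (simp add: R_def A_def x_def norm_mult)
  moreover have "t\<^sup>2 \<le> 1" using ranges by (simp add: power_le_one)
  ultimately have "(1 - t\<^sup>2) * R \<le> (1 - t\<^sup>2) * (A * x)" by (intro mult_left_mono) auto
  with 1 have "(x - A)\<^sup>2 \<le> (t * (1 - A * x))\<^sup>2"
    by (simp add: power2_eq_square algebra_simps)
  moreover have "0 \<le> t * (1 - A * x)" using ranges mult_left_le[of x A] by (intro mult_nonneg_nonneg) auto
  ultimately have "x - A \<le> t * (1 - A * x)" by (rule power2_le_imp_le)
  then have "x * (1 + A * t) \<le> A + t" by (simp add: algebra_simps)
  moreover have "1 + A * t > 0" using ranges by (simp add: add_pos_nonneg)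
  ultimately show ?thesis by (simp add: A_def x_def t_def le_divide_eq)
qed

text \<open>In \<open>y = x\<^sup>2\<close> the right side is the tangent at 1 to the concave
  function \<open>y powr (p / 2)\<close>; Young's inequality with weights \<open>p / 2\<close> and
  \<open>1 - p / 2\<close> proves it.\<close>

lemma powr_half_concave:
  fixes x p :: real
  assumes x: "0 \<le> x" and p: "0 < p" "p \<le> 2"
  shows "x powr p \<le> 1 - p / 2 * (1 - x\<^sup>2)"
proof (cases "x = 0")
  case True
  then show ?thesis using p by simp
next
  case False
  have "x powr p = (x\<^sup>2) powr (p / 2) * 1 powr (1 - p / 2)"
    using x False by (simp add: powr_powr flip: powr_numeral)
  also have "\<dots> \<le> p / 2 * x\<^sup>2 + (1 - p / 2) * 1"
    by (rule Youngs_inequality_0) (use x p False in auto)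
  finally show ?thesis by (simp add: algebra_simps)
qed

text \<open>For the quotient \<open>x\<close> one has \<open>1 - x\<^sup>2 = (1 - a\<^sup>2) * (1 -
  t\<^sup>2) / (1 + a * t)\<^sup>2\<close>. Enlarging the denominator to
  \<open>(1 + t)\<^sup>2\<close> leaves \<open>a\<close> only in \<open>1 - a\<^sup>2\<close>, the
  factor that also governs the series.\<close>

lemma Moebius_powr_le:
  fixes a t p :: real
  assumes a: "0 \<le> a" "a < 1" and t: "0 \<le> t" "t < 1" and p: "0 < p" "p \<le> 2"
  shows "((a + t) / (1 + a * t)) powr p \<le> 1 - (1 - a\<^sup>2) * (p / 2 * ((1 - t) / (1 + t)))"
proof -
  define x where "x = (a + t) / (1 + a * t)"
  have pos: "1 + a * t > 0" using a t by (simp add: add_pos_nonneg)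
  have le: "1 + a * t \<le> 1 + t" using a t by (simp add: mult_left_le_one_le)
  have "(1 - a\<^sup>2) * ((1 - t) / (1 + t)) = (1 - a\<^sup>2) * (1 - t\<^sup>2) / (1 + t)\<^sup>2"
    using t by (simp add: divide_simps power2_eq_square) (simp add: algebra_simps)
  also have "\<dots> \<le> (1 - a\<^sup>2) * (1 - t\<^sup>2) / (1 + a * t)\<^sup>2"
    using a t pos le by (intro divide_left_mono power_mono mult_nonneg_nonneg mult_pos_pos) (auto simp: power_le_one)
  also have "\<dots> = 1 - x\<^sup>2"
    using pos by (simp add: x_def divide_simps power2_eq_square) (simp add: algebra_simps)
  finally have "p / 2 * ((1 - a\<^sup>2) * ((1 - t) / (1 + t))) \<le> p / 2 * (1 - x\<^sup>2)"
    using p by (intro mult_left_mono) auto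
  then have "(1 - a\<^sup>2) * (p / 2 * ((1 - t) / (1 + t))) \<le> p / 2 * (1 - x\<^sup>2)"
    by (simp only: mult.left_commute[of "p / 2"])
  moreover have "x powr p \<le> 1 - p / 2 * (1 - x\<^sup>2)"
    using a t pos p by (intro powr_half_concave) (auto simp: x_def)
  ultimately show ?thesis unfolding x_def by linarith
qed

text \<open>Its sign decides both directions: nonnegative, it gives the inequality; it is also the
  derivative at \<open>a = 1\<close> of the extremal expression, so a negative value gives a
  counterexample.\<close>

definition bohr_gap :: "nat \<Rightarrow> nat \<Rightarrow> real \<Rightarrow> real \<Rightarrow> real \<Rightarrow> real" where
  "bohr_gap k m lam p r = p * ((1 - r ^ m) / (1 + r ^ m)) - 2 * lam * (r ^ k / (1 - r ^ k))"

lemma bohr_gap_strict_antimono: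
  assumes k: "1 \<le> k" and m: "1 \<le> m" and p: "0 < p" and lam: "0 < lam" and r: "0 \<le> r" "r < s" "s < 1"
  shows "bohr_gap k m lam p s < bohr_gap k m lam p r"
proof -
  have pk: "r ^ k < s ^ k" "s ^ k < 1" and pm: "r ^ m < s ^ m" "s ^ m < 1"
    using r k m by (auto intro!: power_strict_mono simp: power_less_one_iff)
  have r0: "0 \<le> r ^ m" "0 \<le> r ^ k" using r by auto
  have "(1 - s ^ m) / (1 + s ^ m) < (1 - r ^ m) / (1 + r ^ m)"
    using pm r0 by (intro frac_less2) auto
  then have "p * ((1 - s ^ m) / (1 + s ^ m)) < p * ((1 - r ^ m) / (1 + r ^ m))"
    using p by (rule mult_strict_left_mono)
  moreover have "r ^ k / (1 - r ^ k) \<le> s ^ k / (1 - s ^ k)"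
    using pk r0 by (intro frac_le) auto
  then have "2 * lam * (r ^ k / (1 - r ^ k)) \<le> 2 * lam * (s ^ k / (1 - s ^ k))"
    using lam by (intro mult_left_mono) auto
  ultimately show ?thesis unfolding bohr_gap_def by linarith
qed

lemma ex1_bohr_root:
  assumes k: "1 \<le> k" and m: "1 \<le> m" and p: "0 < p" and lam: "0 < lam"
  shows "\<exists>!r. is_bohr_root k m lam p r"
proof -
  have root: "is_bohr_root k m lam p r \<longleftrightarrow> 0 < r \<and> r < 1 \<and> bohr_gap k m lam p r = 0" for r
    by (simp add: is_bohr_root_def bohr_gap_def)
  \<comment> \<open>Clearing denominators removes the pole at 1, so the intermediate value theorem
    applies on the closed interval, from \<open>p\<close> at 0 to \<open>- 4 * lam\<close> at
    1.\<close>
  let ?P = "\<lambda>r::real. p * (1 - r ^ m) * (1 - r ^ k) - 2 * lam * r ^ k * (1 + r ^ m)"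
  have "\<exists>r\<ge>0. r \<le> 1 \<and> ?P r = 0"
    by (rule IVT2) (use k m p lam in \<open>auto simp: power_0_left intro!: continuous_intros\<close>)
  then obtain r where r: "0 \<le> r" "r \<le> 1" "?P r = 0" by blast
  have "r \<noteq> 0" "r \<noteq> 1" using r(3) k m p lam by (auto simp: power_0_left)
  then have r01: "0 < r" "r < 1" using r by auto
  then have "1 - r ^ k > 0" "1 + r ^ m > 0" using k by (auto simp: power_less_one_iff add_pos_nonneg)
  then have "bohr_gap k m lam p r = 0"
    using r(3) by (simp add: bohr_gap_def divide_simps)
  then have "is_bohr_root k m lam p r" using r01 by (simp add: root)
  moreover have "s = r" if s: "is_bohr_root k m lam p s" for s
  proof (rule linorder_cases[of s r])
    assume "s < r"
    then show ?thesis
      using bohr_gap_strict_antimono[OF assms, of s r] s r01 \<open>bohr_gap k m lam p r = 0\<close> by (simp add: root)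
  next
    assume "r < s"
    then show ?thesis
      using bohr_gap_strict_antimono[OF assms, of r s] s r01 \<open>bohr_gap k m lam p r = 0\<close> by (simp add: root)
  qed
  ultimately show ?thesis by blast
qed

subsection \<open>Restriction to complex lines\<close>

lemma multilinear_map_scaleC:
  assumes u: "multilinear_map j u" and n: "n \<le> j"
  shows "u (\<lambda>i. if i < n then c *\<^sub>C x else x) = c ^ n *\<^sub>C u (\<lambda>_. x)"
  using n
proof (induction n)
  case (Suc n)
  let ?y = "\<lambda>i. if i < n then c *\<^sub>C x else x"
  have "(\<lambda>i. if i < Suc n then c *\<^sub>C x else x) = ?y(n := c *\<^sub>C x)" "?y(n := x) = ?y"
    by (auto simp: fun_eq_iff less_Suc_eq)
  moreover have "u (?y(n := c *\<^sub>C x)) = c *\<^sub>C u (?y(n := x))"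
    using u Suc.prems unfolding multilinear_map_def by (meson Suc_le_lessD)
  ultimately show ?case using Suc by (simp add: scaleC_scaleC)
qed simp

lemma homogeneous_polynomial_scaleC:
  assumes "homogeneous_polynomial j P"
  shows "P (c *\<^sub>C x) = c ^ j *\<^sub>C P x"
proof -
  obtain u where u: "multilinear_map j u" "\<And>x. P x = u (\<lambda>_. x)"
    using assms by (auto simp: homogeneous_polynomial_def)
  \<comment> \<open>The two sequences differ only from index \<open>j\<close> on, where
    \<open>u\<close> does not look.\<close>
  have "u (\<lambda>_. c *\<^sub>C x) = u (\<lambda>i. if i < j then c *\<^sub>C x else x)"
    by (rule u(1)[unfolded multilinear_map_def, THEN conjunct1, rule_format]) simp
  then show ?thesis using multilinear_map_scaleC[OF u(1) order_refl, of c x] by (simp add: u(2))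
qed

lemma homogeneous_expansion_on_line:
  assumes f: "homogeneous_expansion f P" and e: "norm e = 1" and z: "norm z < 1"
  shows "(\<lambda>j. z ^ j *\<^sub>C P j e) sums f (z *\<^sub>C e)"
proof -
  have "(\<lambda>j. P j (z *\<^sub>C e)) sums f (z *\<^sub>C e)"
    using f e z by (auto simp: homogeneous_expansion_def norm_scaleC)
  moreover have "P j (z *\<^sub>C e) = z ^ j *\<^sub>C P j e" for j
    using f by (intro homogeneous_polynomial_scaleC) (auto simp: homogeneous_expansion_def)
  ultimately show ?thesis by simp
qed

text \<open>Here \<open>X \<noteq> {0}\<close> enters: for \<open>z = 0\<close> the direction has to
  come from another vector.\<close>

lemma polar_decomposition:
  fixes z :: "'a::complex_normed_vector"
  assumes "\<exists>x::'a. x \<noteq> 0"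
  obtains e where "norm e = 1" "z = of_real (norm z) *\<^sub>C e"
proof (cases "z = 0")
  case True
  obtain x :: 'a where "x \<noteq> 0" using assms by blast
  then show ?thesis using that[of "inverse (norm x) *\<^sub>R x"] True by simp
next
  case False
  then show ?thesis using that[of "inverse (norm z) *\<^sub>R z"] by (simp add: scaleC_of_real)
qed

lemma schwarz_mapping_norm_le:
  fixes \<mu> :: "'a::complex_banach \<Rightarrow> 'a"
  assumes ne: "\<exists>x::'a. x \<noteq> 0"
    and \<mu>: "schwarz_mapping \<mu>" "zero_of_order_at_0 n \<mu>" and z: "norm z < 1"
  shows "norm (\<mu> z) \<le> norm z ^ n"
proof -
  obtain Q where Q: "homogeneous_expansion \<mu> Q" "\<And>j x. j < n \<Longrightarrow> Q j x = 0"
    using \<mu>(2) by (auto simp: zero_of_order_at_0_def)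
  obtain e where e: "norm e = 1" "z = of_real (norm z) *\<^sub>C e" using polar_decomposition[OF ne] by blast
  have "norm (\<mu> (of_real (norm z) *\<^sub>C e)) \<le> norm (complex_of_real (norm z)) ^ n"
  proof (rule power_series_Schwarz[where q = "\<lambda>j. Q j e" and F = "\<lambda>\<zeta>. \<mu> (\<zeta> *\<^sub>C e)"])
    fix \<zeta> :: complex assume \<zeta>: "norm \<zeta> < 1"
    show "(\<lambda>j. \<zeta> ^ j *\<^sub>C Q j e) sums \<mu> (\<zeta> *\<^sub>C e)"
      using homogeneous_expansion_on_line[OF Q(1) e(1) \<zeta>] .
    have "\<zeta> *\<^sub>C e \<in> ball 0 1" using \<zeta> e by (simp add: norm_scaleC)
    then have "\<mu> (\<zeta> *\<^sub>C e) \<in> ball 0 1" using \<mu>(1) unfolding schwarz_mapping_def by blast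
    then show "norm (\<mu> (\<zeta> *\<^sub>C e)) \<le> 1" by simp
  qed (use z Q in auto)
  then show ?thesis using e(2) by simp
qed

text \<open>Two different complex lines occur, through \<open>\<mu> k z\<close> for the series and
  through \<open>\<mu> m z\<close> for the first term. They share only \<open>A\<close>, and both
  estimates carry \<open>1 - A\<^sup>2\<close> times a quantity depending on \<open>norm z\<close>;
  the sign of \<open>bohr_gap\<close> compares these.\<close>

lemma bohr_sum_le_1:
  fixes f :: "'a::complex_banach \<Rightarrow> complex"
  assumes ne: "\<exists>x::'a. x \<noteq> 0" and k: "1 \<le> k" and m: "1 \<le> m" and p: "0 < p" "p \<le> 2" and lam: "0 < lam"
    and adm: "admissible f P \<mu>" and z: "norm z < 1" and gap: "0 \<le> bohr_gap k m lam p (norm z)"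
  shows "bohr_sum_converges k P \<mu> z \<and> bohr_sum k m lam p f P \<mu> z \<le> 1"
proof -
  define r s t A where "r = norm z" and "s = r ^ k" and "t = r ^ m" and "A = norm (f 0)"
  have r: "0 \<le> r" "r < 1" using z by (auto simp: r_def)
  have st: "0 \<le> s" "s < 1" "0 \<le> t" "t < 1"
    using r k m by (auto simp: s_def t_def power_less_one_iff)
  have f1: "norm (f x) < 1" if "norm x < 1" for x
    using adm that by (auto simp: admissible_def image_subset_iff)
  have A: "0 \<le> A" "A < 1" by (auto simp: A_def f1)
  have expf: "homogeneous_expansion f P" using adm by (simp add: admissible_def)
  have homP: "P j (c *\<^sub>C x) = c ^ j * P j x" for j c x
    using expf homogeneous_polynomial_scaleC[of j "P j" c x]
    by (simp add: homogeneous_expansion_def scaleC_complex_def)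
  have line: "(\<lambda>j. P j e * \<zeta> ^ j) sums f (\<zeta> *\<^sub>C e)" "norm (f (\<zeta> *\<^sub>C e)) < 1"
    if "norm e = 1" "norm \<zeta> < 1" for e \<zeta>
    using homogeneous_expansion_on_line[OF expf that] f1 that
    by (simp_all add: scaleC_complex_def mult.commute norm_scaleC)
  have \<mu>: "norm (\<mu> n z) \<le> r ^ n" if "1 \<le> n" for n
    using adm that z unfolding admissible_def r_def by (intro schwarz_mapping_norm_le[OF ne]) auto

  obtain e where e: "norm e = 1" "\<mu> k z = of_real (norm (\<mu> k z)) *\<^sub>C e"
    using polar_decomposition[OF ne] by blast
  \<comment> \<open>The majorant is taken at \<open>s\<close>, not at the possibly smaller
    \<open>norm (\<mu> k z)\<close>, to match the term \<open>s / (1 - s)\<close> in the weight of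
    \<open>bohr_sum\<close>.\<close>
  define b where "b j = norm (P (Suc j) e) * s ^ Suc j" for j
  have "P 0 e = f 0" using line(1)[OF e(1), of 0] by (simp add: sums_iff)
  then have P0: "norm (P 0 e) = A" by (simp add: A_def)
  note area = bounded_power_series_Bohr_area[OF line(1)[OF e(1)] less_imp_le[OF line(2)[OF e(1)]] st(1,2)]
  have sb: "summable b" "summable (\<lambda>j. (b j)\<^sup>2)"
    and le: "(\<Sum>j. b j) + (1 / (1 + A) + s / (1 - s)) * (\<Sum>j. (b j)\<^sup>2) \<le> (1 - A\<^sup>2) * (s / (1 - s))"
    using area[folded b_def] by (simp_all add: P0)
  have Pb: "norm (P (Suc j) (\<mu> k z)) \<le> b j" for j
    by (subst e(2)) (use \<mu>[OF k] in \<open>auto simp: homP norm_mult norm_power b_def s_def mult.commute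
        intro!: mult_left_mono power_mono simp del: power_Suc\<close>)
  have Pb2: "(norm (P (Suc j) (\<mu> k z)))\<^sup>2 \<le> (b j)\<^sup>2" for j by (intro power_mono Pb) simp
  have conv: "summable (\<lambda>j. norm (P (Suc j) (\<mu> k z)))" "summable (\<lambda>j. (norm (P (Suc j) (\<mu> k z)))\<^sup>2)"
    by (rule summable_comparison_test'[OF sb(1)], simp add: Pb)
      (rule summable_comparison_test'[OF sb(2)], simp add: Pb2)
  have tail: "(\<Sum>j. norm (P (Suc j) (\<mu> k z)))
      + (1 / (1 + A) + s / (1 - s)) * (\<Sum>j. (norm (P (Suc j) (\<mu> k z)))\<^sup>2) \<le> (1 - A\<^sup>2) * (s / (1 - s))"
  proof -
    have "(\<Sum>j. norm (P (Suc j) (\<mu> k z))) \<le> (\<Sum>j. b j)"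
      by (intro suminf_le conv sb Pb)
    moreover have "(1 / (1 + A) + s / (1 - s)) * (\<Sum>j. (norm (P (Suc j) (\<mu> k z)))\<^sup>2)
        \<le> (1 / (1 + A) + s / (1 - s)) * (\<Sum>j. (b j)\<^sup>2)"
      using A st by (intro mult_left_mono suminf_le conv sb Pb2) auto
    ultimately show ?thesis using le by linarith
  qed

  obtain e' where e': "norm e' = 1" "\<mu> m z = of_real (norm (\<mu> m z)) *\<^sub>C e'"
    using polar_decomposition[OF ne] by blast
  define x where "x = norm (\<mu> m z)"
  have x: "0 \<le> x" "x \<le> t" using \<mu>[OF m] by (auto simp: x_def t_def)
  have "norm (f (of_real x *\<^sub>C e')) \<le> (norm (f (0 *\<^sub>C e')) + norm (complex_of_real x))
      / (1 + norm (f (0 *\<^sub>C e')) * norm (complex_of_real x))"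
    using x st by (intro bounded_power_series_Schwarz_Pick[where g = "\<lambda>\<zeta>. f (\<zeta> *\<^sub>C e')", OF line[OF e'(1)]]) auto
  then have "norm (f (\<mu> m z)) \<le> (A + x) / (1 + A * x)"
    using e'(2) x by (simp add: A_def x_def)
  also have "\<dots> \<le> (A + t) / (1 + A * t)"
  proof -
    \<comment> \<open>Cross-multiplied difference of the two quotients.\<close>
    have "(t - x) * (1 - A * A) \<ge> 0"
      using x A mult_left_le[of A A] by (intro mult_nonneg_nonneg) auto
    moreover have "1 + A * x > 0" "1 + A * t > 0" using A x st by (auto intro: add_pos_nonneg)
    ultimately show ?thesis by (simp add: frac_le_eq divide_le_0_iff) (simp add: algebra_simps)
  qed
  finally have "norm (f (\<mu> m z)) powr p \<le> ((A + t) / (1 + A * t)) powr p"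
    using p by (intro powr_mono2) auto
  also have "\<dots> \<le> 1 - (1 - A\<^sup>2) * (p / 2 * ((1 - t) / (1 + t)))"
    by (rule Moebius_powr_le[OF A st(3,4) p])
  also have "\<dots> \<le> 1 - (1 - A\<^sup>2) * (lam * (s / (1 - s)))"
  proof -
    have "lam * (s / (1 - s)) \<le> p / 2 * ((1 - t) / (1 + t))"
    proof -
      have "lam * Y \<le> p / 2 * X" if "0 \<le> p * X - 2 * lam * Y" for X Y
        using that by simp
      then show ?thesis using gap unfolding bohr_gap_def s_def t_def r_def by blast
    qed
    then show ?thesis using A by (intro diff_left_mono mult_left_mono) (auto simp: power_le_one)
  qed
  finally have "norm (f (\<mu> m z)) powr p + lam * ((1 - A\<^sup>2) * (s / (1 - s))) \<le> 1"
    by (simp add: mult.left_commute)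
  moreover have "bohr_sum k m lam p f P \<mu> z \<le> norm (f (\<mu> m z)) powr p + lam * ((1 - A\<^sup>2) * (s / (1 - s)))"
    using tail lam unfolding bohr_sum_def A_def s_def r_def by (intro add_left_mono mult_left_mono) auto
  ultimately show ?thesis using conv by (simp add: bohr_sum_converges_def)
qed

subsection \<open>Sharpness\<close>

text \<open>The expression equals 1 at \<open>a = 1\<close> and has the negative derivative
  \<open>bohr_gap\<close> there, so it exceeds 1 slightly to the left.\<close>

lemma bohr_gap_neg_witness:
  assumes k: "1 \<le> k" and m: "1 \<le> m" and r: "0 < r" "r < 1" and gap: "bohr_gap k m lam p r < 0"
  shows "\<exists>a. 0 < a \<and> a < 1 \<and>
    1 < ((a + r ^ m) / (1 + a * r ^ m)) powr p + lam * ((1 - a\<^sup>2) * (r ^ k / (1 - a * r ^ k)))"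
proof -
  define s t where "s = r ^ k" and "t = r ^ m"
  have st: "0 < s" "s < 1" "0 < t" "t < 1"
    using r k m by (auto simp: s_def t_def power_less_one_iff)
  define \<Phi> where "\<Phi> a = ((a + t) / (1 + a * t)) powr p + lam * ((1 - a\<^sup>2) * (s / (1 - a * s)))" for a
  have x: "((\<lambda>a. (a + t) / (1 + a * t)) has_real_derivative (1 - t) / (1 + t)) (at 1)"
    using st by (auto intro!: derivative_eq_intros simp: divide_simps power2_eq_square) (simp add: algebra_simps)
  have 1: "((\<lambda>a. ((a + t) / (1 + a * t)) powr p) has_real_derivative p * ((1 - t) / (1 + t))) (at 1)"
    using DERIV_fun_powr[OF x, of p] st by simp
  \<comment> \<open>As \<open>1 - a\<^sup>2\<close> vanishes at 1, only its own derivative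
    \<open>- 2\<close> contributes.\<close>
  have 2: "((\<lambda>a. lam * ((1 - a\<^sup>2) * (s / (1 - a * s)))) has_real_derivative - (2 * lam * (s / (1 - s)))) (at 1)"
    using st by (auto intro!: derivative_eq_intros simp: divide_simps)
  have "(\<Phi> has_real_derivative bohr_gap k m lam p r) (at 1)"
    using DERIV_add[OF 1 2] by (simp add: \<Phi>_def[abs_def] bohr_gap_def s_def t_def)
  then obtain d where d: "d > 0" "\<And>h. 0 < h \<Longrightarrow> h < d \<Longrightarrow> \<Phi> 1 < \<Phi> (1 - h)"
    using DERIV_neg_dec_left gap by blast
  define h where "h = min (d / 2) (1 / 2)"
  have "0 < h" "h < d" "h < 1" using d(1) by (auto simp: h_def)
  moreover have "\<Phi> 1 = 1" using st by (simp add: \<Phi>_def)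
  ultimately have "0 < 1 - h" "1 - h < 1" "1 < \<Phi> (1 - h)" using d(2)[of h] by auto
  then show ?thesis unfolding \<Phi>_def s_def t_def by blast
qed

section \<open>Extremal maps built from a norming functional\<close>

context complex_functional
begin

lemma bounded_linear: "bounded_linear l"
  by (rule bounded_linear_intro[where K = 1])
    (simp_all add: add norm_le scaleC scaleR_conv_of_real flip: scaleC_of_real)

lemma norm_less: "norm x < r \<Longrightarrow> norm (l x) < r"
  using norm_le by (rule le_less_trans)

lemma zero [simp]: "l 0 = 0"
  using scaleC[of 0 0] by simp

lemma comp_has_derivative:
  assumes "h holomorphic_on ball 0 1" "x \<in> ball 0 1"
  obtains D where "((\<lambda>x. h (l x)) has_derivative (\<lambda>v. D * l v)) (at x)"
proof -
  have "l x \<in> ball 0 1" using norm_le[of x] assms by simp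
  then obtain D where "(h has_field_derivative D) (at (l x))"
    using assms(1) holomorphic_on_imp_differentiable_at[of h "ball 0 1" "l x"]
    by (auto simp: field_differentiable_def)
  then have "(h has_derivative (*) D) (at (l x))" by (rule has_field_derivative_imp_has_derivative)
  then show ?thesis
    using has_derivative_compose[OF bounded_linear.has_derivative[OF bounded_linear has_derivative_ident], of h "(*) D" x UNIV] that
    by simp
qed

lemma holomorphic_map_on_compose:
  assumes "h holomorphic_on ball 0 1"
  shows "holomorphic_map_on (\<lambda>x. h (l x)) (ball 0 1)"
  unfolding holomorphic_map_on_def
proof
  fix x :: 'a assume "x \<in> ball 0 1"
  then obtain D where "((\<lambda>x. h (l x)) has_derivative (\<lambda>v. D * l v)) (at x)"
    using comp_has_derivative[OF assms] by blast
  then show "\<exists>D. ((\<lambda>x. h (l x)) has_derivative D) (at x) \<and> (\<forall>c v. D (c *\<^sub>C v) = c *\<^sub>C D v)"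
    by (intro exI[of _ "\<lambda>v. D * l v"]) (simp add: scaleC scaleC_complex_def mult_ac)
qed

lemma holomorphic_map_on_scaleC:
  assumes "h holomorphic_on ball 0 1"
  shows "holomorphic_map_on (\<lambda>x. h (l x) *\<^sub>C x) (ball 0 1)"
  unfolding holomorphic_map_on_def
proof
  fix x :: 'a assume "x \<in> ball 0 1"
  then obtain D where "((\<lambda>x. h (l x)) has_derivative (\<lambda>v. D * l v)) (at x)"
    using comp_has_derivative[OF assms] by blast
  from bounded_bilinear.FDERIV[OF bounded_bilinear_scaleC this has_derivative_ident]
  show "\<exists>D. ((\<lambda>x. h (l x) *\<^sub>C x) has_derivative D) (at x) \<and> (\<forall>c v. D (c *\<^sub>C v) = c *\<^sub>C D v)"
    by (intro exI[of _ "\<lambda>v. h (l x) *\<^sub>C v + (D * l v) *\<^sub>C x"])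
      (simp add: scaleC scaleC_scaleC scaleC_add_right mult_ac)
qed

lemma prod_upd:
  fixes i d :: nat
  assumes "i < d"
  shows "(\<Prod>i'<d. l ((x(i := v)) i')) = l v * (\<Prod>i'\<in>{..<d} - {i}. l (x i'))"
proof -
  have "(\<Prod>i'\<in>{..<d} - {i}. l ((x(i := v)) i')) = (\<Prod>i'\<in>{..<d} - {i}. l (x i'))"
    by (rule prod.cong) auto
  then show ?thesis
    using assms prod.remove[of "{..<d}" i "\<lambda>i'. l ((x(i := v)) i')"] by simp
qed

lemma continuous_on_prod_coordinates:
  "continuous_on UNIV (\<lambda>x::nat \<Rightarrow> 'a. c * (\<Prod>i<d. l (x i)))"
  by (intro continuous_intros bounded_linear.continuous_on[OF bounded_linear]
      continuous_on_product_coordinates)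

lemma homogeneous_polynomial_power: "homogeneous_polynomial d (\<lambda>z. c * l z ^ d)"
  unfolding homogeneous_polynomial_def
proof (intro exI[of _ "\<lambda>x. c * (\<Prod>i<d. l (x i))"] conjI)
  show "multilinear_map d (\<lambda>x. c * (\<Prod>i<d. l (x i)))"
    unfolding multilinear_map_def
    by (simp add: prod_upd add scaleC scaleC_complex_def algebra_simps del: fun_upd_apply)
qed (simp_all add: continuous_on_prod_coordinates)

text \<open>In the multilinear form the slots below \<open>d\<close> go through \<open>l\<close> and
  slot \<open>d\<close> supplies the vector, hence the degree \<open>Suc d\<close>.\<close>

lemma homogeneous_polynomial_power_scaleC:
  "homogeneous_polynomial (Suc d) (\<lambda>z. (c * l z ^ d) *\<^sub>C z)"
  unfolding homogeneous_polynomial_def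
proof (intro exI[of _ "\<lambda>x. (c * (\<Prod>i<d. l (x i))) *\<^sub>C x d"] conjI)
  let ?u = "\<lambda>x::nat \<Rightarrow> 'a. (c * (\<Prod>i<d. l (x i))) *\<^sub>C x d"
  have upd_last: "?u (x(d := v)) = (c * (\<Prod>i<d. l (x i))) *\<^sub>C v" for x v
    by simp
  have upd: "?u (x(i := v)) = (l v * (c * (\<Prod>i'\<in>{..<d} - {i}. l (x i')))) *\<^sub>C x d" if "i < d" for x i v
    unfolding prod_upd[OF that] using that by (simp add: mult_ac)
  have "?u (x(i := v + w)) = ?u (x(i := v)) + ?u (x(i := w))"
    "?u (x(i := b *\<^sub>C v)) = b *\<^sub>C ?u (x(i := v))" if i: "i < Suc d" for x i v w b
  proof -
    consider "i < d" | "i = d" using i by linarith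
    then have "?u (x(i := v + w)) = ?u (x(i := v)) + ?u (x(i := w)) \<and>
        ?u (x(i := b *\<^sub>C v)) = b *\<^sub>C ?u (x(i := v))"
    proof cases
      case 1
      show ?thesis unfolding upd[OF 1]
        by (simp add: add scaleC distrib_right scaleC_add_left scaleC_scaleC mult.assoc)
    next
      case 2
      show ?thesis unfolding 2 upd_last by (simp add: scaleC_add_right scaleC_scaleC mult.commute)
    qed
    then show "?u (x(i := v + w)) = ?u (x(i := v)) + ?u (x(i := w))"
      "?u (x(i := b *\<^sub>C v)) = b *\<^sub>C ?u (x(i := v))" by blast+
  qed
  then show "multilinear_map (Suc d) ?u"
    unfolding multilinear_map_def by (simp del: fun_upd_apply)
  show "continuous_on UNIV ?u"
    by (rule bounded_bilinear.continuous_on[OF bounded_bilinear_scaleC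
        continuous_on_prod_coordinates continuous_on_product_coordinates])
qed simp

lemma schwarz_mapping_power:
  "schwarz_mapping (\<lambda>z. (- (l z ^ d)) *\<^sub>C z)"
  unfolding schwarz_mapping_def
proof (intro conjI)
  show "holomorphic_map_on (\<lambda>z. (- (l z ^ d)) *\<^sub>C z) (ball 0 1)"
    by (rule holomorphic_map_on_scaleC[of "\<lambda>w. - (w ^ d)"]) (intro holomorphic_intros)
  have "norm (l z ^ d) * norm z \<le> norm z" if "norm z < 1" for z
    using norm_le[of z] that by (intro mult_left_le_one_le) (auto simp: norm_power power_le_one)
  then show "(\<lambda>z. (- (l z ^ d)) *\<^sub>C z) ` ball 0 1 \<subseteq> ball 0 1"
    by (force simp: norm_scaleC)
qed simp

lemma zero_of_order_power:
  assumes e: "l e = 1"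
  shows "zero_of_order_at_0 (Suc d) (\<lambda>z. (- (l z ^ d)) *\<^sub>C z)"
proof -
  define Q where "Q j = (if j = Suc d then \<lambda>z. (- 1 * l z ^ d) *\<^sub>C z else (\<lambda>_. 0))" for j
  have "homogeneous_polynomial j (\<lambda>_::'a. 0::'a)" for j
    unfolding homogeneous_polynomial_def multilinear_map_def by (intro exI[of _ "\<lambda>_. 0"]) simp
  then have "homogeneous_polynomial j (Q j)" for j
    using homogeneous_polynomial_power_scaleC[of d "- 1"] by (simp add: Q_def)
  moreover have "(\<lambda>j. Q j z) sums ((- (l z ^ d)) *\<^sub>C z)" for z
    using sums_single[of "Suc d" "\<lambda>_. (- (l z ^ d)) *\<^sub>C z"]
    by (rule sums_cong[THEN iffD1, rotated]) (simp add: Q_def)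
  moreover have "Q (Suc d) e \<noteq> 0"
    using e zero by (auto simp: Q_def scaleC_minus_left)
  ultimately show ?thesis
    unfolding zero_of_order_at_0_def homogeneous_expansion_def
    by (intro exI[of _ Q]) (auto simp: Q_def)
qed

text \<open>The extremal function is \<open>(a - l z) / (1 - a l z)\<close>. The sign in the extremal Schwarz mappings
  sends \<open>r e\<close> to \<open>- r ^ n e\<close>, where this function attains the Schwarz--Pick bound.\<close>

lemma bohr_sum_extremal:
  assumes e: "norm e = 1" "l e = 1" and k: "1 \<le> k" and m: "1 \<le> m" and lam: "0 < lam"
    and a: "0 < a" "a < 1" and r: "0 < r" "r < 1"
  obtains f :: "'a \<Rightarrow> complex" and P \<mu> where "admissible f P \<mu>" "bohr_sum_converges k P \<mu> (r *\<^sub>R e)"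
    "((a + r ^ m) / (1 + a * r ^ m)) powr p + lam * ((1 - a\<^sup>2) * (r ^ k / (1 - a * r ^ k)))
      \<le> bohr_sum k m lam p f P \<mu> (r *\<^sub>R e)"
proof -
  define f where "f z = - Moebius_function 0 (of_real a) (l z)" for z
  \<comment> \<open>From \<open>(a - w) / (1 - a * w)\<close>, whose coefficient at
    \<open>w ^ j\<close> is \<open>- (1 - a\<^sup>2) * a ^ (j - 1)\<close> for
    \<open>j \<ge> 1\<close>.\<close>
  define P where "P j z = (if j = 0 then complex_of_real a else - of_real ((1 - a\<^sup>2) * a ^ (j - 1))) * l z ^ j" for j z
  \<comment> \<open>The vector factor \<open>z\<close> supplies one degree, hence
    \<open>n - 1\<close>. At \<open>n = 0\<close> this is \<open>- z\<close>, outside the range that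
    \<open>admissible\<close> constrains.\<close>
  define \<mu> where "\<mu> n z = (- (l z ^ (n - 1))) *\<^sub>C z" for n z
  have na: "norm (complex_of_real a) < 1" using a by simp
  have f: "f z = (of_real a - l z) / (1 - of_real a * l z)" for z
    unfolding f_def Moebius_function_simple minus_divide_left by simp
  have "holomorphic_map_on f (ball 0 1)"
    unfolding f_def
    by (rule holomorphic_map_on_compose[of "\<lambda>w. - Moebius_function 0 (of_real a) w"])
      (intro holomorphic_intros Moebius_function_holomorphic na)
  moreover have "f ` ball 0 1 \<subseteq> ball 0 1"
    by (auto simp: f_def intro!: Moebius_function_norm_lt_1 na norm_less)
  moreover have "homogeneous_expansion f P"
    unfolding homogeneous_expansion_def
  proof (intro conjI allI ballI)
    show "homogeneous_polynomial j (P j)" for j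
      unfolding P_def by (rule homogeneous_polynomial_power)
    fix z :: 'a assume "z \<in> ball 0 1"
    then have "norm (l z) < 1" using norm_le[of z] by simp
    then have "norm (of_real a * l z) < 1 * 1"
      using a unfolding norm_mult by (intro mult_strict_mono) auto
    then have aw: "norm (of_real a * l z) < 1" by simp
    then have ne: "1 - of_real a * l z \<noteq> 0" by auto
    have "(\<lambda>j. (- of_real (1 - a\<^sup>2) * l z) * (of_real a * l z) ^ j) sums
        ((- of_real (1 - a\<^sup>2) * l z) * (1 / (1 - of_real a * l z)))"
      by (intro sums_mult geometric_sums aw)
    also have "(\<lambda>j. (- of_real (1 - a\<^sup>2) * l z) * (of_real a * l z) ^ j) = (\<lambda>j. P (Suc j) z)"
      by (intro ext) (simp add: P_def power_mult_distrib algebra_simps)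
    finally have "(\<lambda>j. P j z) sums ((- of_real (1 - a\<^sup>2) * l z) * (1 / (1 - of_real a * l z)) + P 0 z)"
      by (rule sums_Suc)
    also have "(- of_real (1 - a\<^sup>2) * l z) * (1 / (1 - of_real a * l z)) + P 0 z = f z"
      using ne by (simp add: P_def f divide_simps power2_eq_square) (simp add: algebra_simps)
    finally show "(\<lambda>j. P j z) sums f z" .
  qed
  moreover have "schwarz_mapping (\<mu> n) \<and> zero_of_order_at_0 n (\<mu> n)" if "n \<ge> 1" for n
    using schwarz_mapping_power zero_of_order_power[OF e(2), of "n - 1"] that
    by (simp add: \<mu>_def[abs_def])
  ultimately have adm: "admissible f P \<mu>" by (simp add: admissible_def)

  define s t where "s = r ^ k" and "t = r ^ m"
  have st: "0 < s" "s < 1" "0 < t" "t < 1"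
    using r k m by (auto simp: s_def t_def power_less_one_iff)
  have as: "0 \<le> a * s" "a * s < 1" using a st mult_strict_mono[of a 1 s 1] by auto
  have lz: "l (r *\<^sub>R e) = of_real r" using e by (simp add: scaleC flip: scaleC_of_real)
  have l\<mu>: "l (\<mu> n (r *\<^sub>R e)) = - of_real (r ^ n)" if "1 \<le> n" for n
    using that by (cases n) (simp_all add: \<mu>_def scaleC lz)
  have Pn: "norm (P (Suc j) (\<mu> k (r *\<^sub>R e))) = ((1 - a\<^sup>2) * s) * (a * s) ^ j" for j
  proof -
    have "norm (complex_of_real (1 - a\<^sup>2)) = 1 - a\<^sup>2" using a by (simp only: norm_of_real) (simp add: power_le_one)
    then show ?thesis
      using a r by (simp add: P_def l\<mu>[OF k] norm_mult norm_power power_mult_distrib s_def del: of_real_diff)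
  qed
  have sum1: "(\<lambda>j. norm (P (Suc j) (\<mu> k (r *\<^sub>R e)))) sums (((1 - a\<^sup>2) * s) * (1 / (1 - a * s)))"
    unfolding Pn using as by (intro sums_mult geometric_sums) auto
  have sq: "(norm (P (Suc j) (\<mu> k (r *\<^sub>R e))))\<^sup>2 = ((1 - a\<^sup>2) * s)\<^sup>2 * ((a * s)\<^sup>2) ^ j" for j
    unfolding Pn by (subst power_mult_distrib) (simp only: power_mult[symmetric] mult.commute[of j 2])
  have sum2: "summable (\<lambda>j. (norm (P (Suc j) (\<mu> k (r *\<^sub>R e))))\<^sup>2)"
  proof -
    have "norm ((a * s)\<^sup>2) < 1"
      unfolding norm_power using as by (intro power_less_one_iff[THEN iffD2]) auto
    then show ?thesis unfolding sq by (intro summable_mult summable_geometric)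
  qed
  have fm: "norm (f (\<mu> m (r *\<^sub>R e))) = (a + t) / (1 + a * t)"
  proof -
    have "f (\<mu> m (r *\<^sub>R e)) = of_real ((a + t) / (1 + a * t))"
      by (simp add: f l\<mu>[OF m] t_def)
    then show ?thesis using a st by (simp only: norm_of_real) simp
  qed
  show ?thesis
  proof (rule that[OF adm])
    show "bohr_sum_converges k P \<mu> (r *\<^sub>R e)"
      using sum1 sum2 by (auto simp: bohr_sum_converges_def sums_iff)
    \<comment> \<open>With \<open>K \<ge> 0\<close> the squared series can only raise the sum, so
      the first series suffices for the lower bound.\<close>
    define K where "K = 1 / (1 + norm (f 0)) + norm (r *\<^sub>R e) ^ k / (1 - norm (r *\<^sub>R e) ^ k)"
    have "0 \<le> K" using st r e by (auto simp: K_def s_def intro!: add_nonneg_nonneg divide_nonneg_nonneg)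
    then have "0 \<le> lam * (K * (\<Sum>j. (norm (P (Suc j) (\<mu> k (r *\<^sub>R e))))\<^sup>2))"
      using lam by (intro mult_nonneg_nonneg suminf_nonneg sum2) auto
    then show "((a + r ^ m) / (1 + a * r ^ m)) powr p + lam * ((1 - a\<^sup>2) * (r ^ k / (1 - a * r ^ k)))
        \<le> bohr_sum k m lam p f P \<mu> (r *\<^sub>R e)"
      using sums_unique[OF sum1] unfolding bohr_sum_def fm K_def[symmetric] s_def[symmetric] t_def[symmetric]
      by (simp add: distrib_left)
  qed
qed

end

theorem theorem9:
  fixes k m :: nat and p lam :: real
  assumes "\<exists>x::'a::complex_banach. x \<noteq> 0"
    and "1 \<le> k" and "1 \<le> m" and "0 < p" and "p \<le> 2" and "0 < lam"
  shows "(\<exists>!r. is_bohr_root k m lam p r) \<and>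
    (\<forall>(f :: 'a \<Rightarrow> complex) P \<mu> z.
       admissible f P \<mu> \<and> norm z \<le> bohr_radius k m lam p \<longrightarrow>
       bohr_sum_converges k P \<mu> z \<and> bohr_sum k m lam p f P \<mu> z \<le> 1) \<and>
    (\<forall>R. bohr_radius k m lam p < R \<and> R < 1 \<longrightarrow>
       (\<exists>(f :: 'a \<Rightarrow> complex) P \<mu> z.
          admissible f P \<mu> \<and> z \<in> ball 0 1 \<and> norm z \<le> R \<and>
          bohr_sum_converges k P \<mu> z \<and> bohr_sum k m lam p f P \<mu> z > 1))"
proof (intro conjI allI impI)
  show ex1: "\<exists>!r. is_bohr_root k m lam p r" using assms by (intro ex1_bohr_root)
  let ?R = "bohr_radius k m lam p"
  have "is_bohr_root k m lam p ?R" unfolding bohr_radius_def by (rule theI'[OF ex1])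
  then have R: "0 < ?R" "?R < 1" "bohr_gap k m lam p ?R = 0"
    by (auto simp: is_bohr_root_def bohr_gap_def)
  {
    fix f :: "'a \<Rightarrow> complex" and P \<mu> and z :: 'a
    assume *: "admissible f P \<mu> \<and> norm z \<le> ?R"
    \<comment> \<open>On the boundary the gap is 0; inside, strict monotonicity makes it
      positive.\<close>
    have "0 \<le> bohr_gap k m lam p (norm z)"
      using bohr_gap_strict_antimono[of k m p lam "norm z" ?R] assms * R by (cases "norm z = ?R") auto
    with * R assms show "bohr_sum_converges k P \<mu> z" "bohr_sum k m lam p f P \<mu> z \<le> 1"
      using bohr_sum_le_1[of k m p lam f P \<mu> z] by auto
  next
    \<comment> \<open>This \<open>r\<close> is the \<open>R\<close> of the statement; the
      counterexample has norm exactly \<open>r\<close>.\<close>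
    fix r assume r: "?R < r \<and> r < 1"
    then have r01: "0 < r" "r < 1" using R by auto
    have "bohr_gap k m lam p r < 0"
      using bohr_gap_strict_antimono[of k m p lam ?R r] assms r R by auto
    then obtain a where a: "0 < a" "a < 1"
      "1 < ((a + r ^ m) / (1 + a * r ^ m)) powr p + lam * ((1 - a\<^sup>2) * (r ^ k / (1 - a * r ^ k)))"
      using bohr_gap_neg_witness[of k m r lam p] assms r R by auto
    obtain e :: 'a where e: "norm e = 1" using polar_decomposition[OF assms(1)] by blast
    obtain l :: "'a \<Rightarrow> complex" where l: "complex_functional l" "l e = 1"
      by (rule norming_functional[OF e])
    interpret complex_functional l by (rule l(1))
    obtain f :: "'a \<Rightarrow> complex" and P \<mu> where f: "admissible f P \<mu>" "bohr_sum_converges k P \<mu> (r *\<^sub>R e)"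
      "((a + r ^ m) / (1 + a * r ^ m)) powr p + lam * ((1 - a\<^sup>2) * (r ^ k / (1 - a * r ^ k)))
        \<le> bohr_sum k m lam p f P \<mu> (r *\<^sub>R e)"
      by (rule bohr_sum_extremal[OF e l(2) assms(2,3,6) a(1,2) r01])
    have "r *\<^sub>R e \<in> ball 0 1" "norm (r *\<^sub>R e) \<le> r" using r R e by simp_all
    moreover have "1 < bohr_sum k m lam p f P \<mu> (r *\<^sub>R e)" using a(3) f(3) by (rule less_le_trans)
    ultimately show "\<exists>(f :: 'a \<Rightarrow> complex) P \<mu> z. admissible f P \<mu> \<and> z \<in> ball 0 1 \<and> norm z \<le> r \<and>
        bohr_sum_converges k P \<mu> z \<and> 1 < bohr_sum k m lam p f P \<mu> z"
      using f(1,2) by blast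
  }
qed

end
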